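(* Let $\mathbb{T}$ be an almost periodic time scale, let $A\in\mathcal{R}(\mathbb{T},\mathbb{R}^{n\times n})$ be almost automorphic and nonsingular on $\mathbb{T}$, and let the sets $\{A^{-1}(t)\}_{t\in\mathbb{T}}$ and $\{(I+\mu(t)A(t))^{-1}\}_{t\in\mathbb{T}}$ be bounded. Then $A^{-1}(t)$ and $(I+\mu(t)A(t))^{-1}$ are almost automorphic on $\mathbb{T}$. Moreover, suppose that $f\in AA(\mathbb{T},\mathbb{R}^{n})$ and that the homogeneous equation $$x^{\Delta}(t)=A(t)x(t),\quad t\in\mathbb{T},$$ admits an exponential dichotomy on $\mathbb{T}$ (with fundamental solution matrix $X(t)$ and projection $P$). Then the equation $$x^{\Delta}(t)=A(t)x(t)+f(t),\quad t\in\mathbb{T},$$ has a solution $x\in AA(\mathbb{T},\mathbb{R}^{n})$, and $x(t)$ is expressed as $$x(t)=\int_{-\infty}^{t}X(t)PX^{-1}(\sigma(s))f(s)\Delta s-\int_{t}^{+\infty}X(t)(I-P)X^{-1}(\sigma(s))f(s)\Delta s.$$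
   Context: A time scale $\mathbb{T}$ is a nonempty closed subset of $\mathbb{R}$; $\sigma(t)=\inf\{s\in\mathbb{T}:s>t\}$ is the forward jump operator, $\mu(t)=\sigma(t)-t$ the graininess. $x^{\Delta}$ and $\int\cdot\,\Delta s$ denote the usual delta derivative and delta integral on $\mathbb{T}$. A function on $\mathbb{T}$ is rd-continuous if it is continuous at right-dense points ($\sigma(t)=t$) and has left-sided limits at left-dense points; a matrix function is rd-continuous if each entry is. $\mathcal{R}(\mathbb{T},\mathbb{R}^{n\times n})$ is the set of rd-continuous $n\times n$ matrix functions $A$ on $\mathbb{T}$ that are regressive, i.e. $I+\mu(t)A(t)$ is invertible for all $t\in\mathbb{T}$. For a constant $\alpha>0$, $\ominus\alpha=-\alpha/(1+\mu\alpha)$, and $e_{r}(t,s)$ is the time scale exponential, the unique solution of $y^{\Delta}=r(t)y$, $y(s)=1$. For $\tau\in\mathbb{R}$ put $\mathbb{T}_\tau=\mathbb{T}\cap\{t-\tau:t\in\mathbb{T}\}$, and $\mathrm{dist}(\mathbb{T},\mathbb{T}_\tau)=\max\{\sup_{t\in\mathbb{T}}\mathrm{dist}(t,\mathbb{T}_\tau),\sup_{t\in\mathbb{T}_\tau}\mathrm{dist}(t,\mathbb{T})\}$, where $\mathrm{dist}(t,S)=\inf_{s\in S}|t-s|$. $\mathbb{T}$ is called an almost periodic time scale if for every $\varepsilon>0$ there is $l(\varepsilon)>0$ such that each interval of length $l(\varepsilon)$ contains a $\tau$ with $\mathbb{T}_\tau\neq\emptyset$ and $\mathrm{dist}(\mathbb{T},\mathbb{T}_\tau)<\varepsilon$.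 Let $\Pi=\{\tau\in\mathbb{R}:\mathbb{T}_\tau\neq\emptyset\}$ and $\widetilde{\mathbb{T}}=\bigcap_{\tau\in\Pi}\mathbb{T}_\tau$. A bounded rd-continuous function $h:\mathbb{T}\to X$ ($X$ a Banach space) is almost automorphic, written $h\in AA(\mathbb{T},X)$, if for every sequence $(s_n')\subset\Pi$ there is a subsequence $(s_n)$ such that $\lim_{n\to\infty}h(t+s_n)=\bar h(t)$ is well defined for each $t\in\widetilde{\mathbb{T}}$ and $\lim_{n\to\infty}\bar h(t-s_n)=h(t)$ for each $t\in\widetilde{\mathbb{T}}$. A matrix function is almost automorphic if each entry is. The linear system $x^{\Delta}=A(t)x$ admits an exponential dichotomy on $\mathbb{T}$ if there exist positive constants $k,\alpha$, a projection $P$ and a fundamental solution matrix $X(t)$ of the system such that $|X(t)PX^{-1}(\sigma(s))|\leq k e_{\ominus\alpha}(t,\sigma(s))$ for $s,t\in\mathbb{T}$, $t\geq\sigma(s)$, and $|X(t)(I-P)X^{-1}(\sigma(s))|\leq k e_{\ominus\alpha}(\sigma(s),t)$ for $s,t\in\mathbb{T}$, $t\leq\sigma(s)$, where $|\cdot|$ is a matrix norm, e.g. $|A|=(\sum_{i,j}|a_{ij}|^2)^{1/2}$. *)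

theory Defs
  imports "HOL-Analysis.Analysis"
begin

text \<open>
  Functions on a time scale \<open>T\<close> are total functions on \<^typ>\<open>real\<close>; only their values on \<open>T\<close>
  matter.
\<close>

definition time_scale :: "real set \<Rightarrow> bool" where
  "time_scale T \<longleftrightarrow> T \<noteq> {} \<and> closed T"

text \<open>Usual convention \<open>inf {} = sup T\<close>, i.e. \<open>\<sigma>(max T) = max T\<close>; dually for the backward jump.\<close>

definition fwd_jump :: "real set \<Rightarrow> real \<Rightarrow> real" where
  "fwd_jump T t = (if \<exists>s\<in>T. s > t then Inf {s \<in> T. s > t} else t)"

definition bwd_jump :: "real set \<Rightarrow> real \<Rightarrow> real" where
  "bwd_jump T t = (if \<exists>s\<in>T. s < t then Sup {s \<in> T. s < t} else t)"

definition graininess :: "real set \<Rightarrow> real \<Rightarrow> real" where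
  "graininess T t = fwd_jump T t - t"

definition rd_continuous :: "real set \<Rightarrow> (real \<Rightarrow> 'a::real_normed_vector) \<Rightarrow> bool" where
  "rd_continuous T f \<longleftrightarrow>
     (\<forall>t\<in>T. fwd_jump T t = t \<longrightarrow> continuous (at t within T) f) \<and>
     (\<forall>t\<in>T. bwd_jump T t = t \<longrightarrow> (\<exists>l. (f \<longlongrightarrow> l) (at t within (T \<inter> {..<t}))))"

definition mat_rd_continuous :: "real set \<Rightarrow> (real \<Rightarrow> real^'n^'m) \<Rightarrow> bool" where
  "mat_rd_continuous T A \<longleftrightarrow> (\<forall>i j. rd_continuous T (\<lambda>t. A t $ i $ j))"

definition rd_regressive :: "real set \<Rightarrow> (real \<Rightarrow> real^'n^'n) \<Rightarrow> bool" where
  "rd_regressive T A \<longleftrightarrow>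
     mat_rd_continuous T A \<and> (\<forall>t\<in>T. invertible (mat 1 + graininess T t *\<^sub>R A t))"

text \<open>
  At a left-scattered maximum of \<open>T\<close> the condition below holds for every \<open>D\<close>, so requiring it on
  all of \<open>T\<close> is the same as requiring it on the truncated set on which delta derivatives are
  usually considered.
\<close>

definition has_delta_derivative ::
    "real set \<Rightarrow> (real \<Rightarrow> 'a::real_normed_vector) \<Rightarrow> 'a \<Rightarrow> real \<Rightarrow> bool" where
  "has_delta_derivative T f D t \<longleftrightarrow>
     (\<forall>\<epsilon>>0. \<exists>\<delta>>0. \<forall>s\<in>T. \<bar>s - t\<bar> < \<delta> \<longrightarrow>
        norm (f (fwd_jump T t) - f s - (fwd_jump T t - s) *\<^sub>R D) \<le> \<epsilon> * \<bar>fwd_jump T t - s\<bar>)"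

text \<open>The Cauchy delta integral: the increment of a delta antiderivative.\<close>

definition has_delta_integral ::
    "real set \<Rightarrow> (real \<Rightarrow> 'a::real_normed_vector) \<Rightarrow> real \<Rightarrow> real \<Rightarrow> 'a \<Rightarrow> bool" where
  "has_delta_integral T g a b I \<longleftrightarrow>
     (\<exists>G. (\<forall>t\<in>T. has_delta_derivative T G (g t) t) \<and> I = G b - G a)"

definition has_delta_integral_to_top ::
    "real set \<Rightarrow> (real \<Rightarrow> 'a::real_normed_vector) \<Rightarrow> real \<Rightarrow> 'a \<Rightarrow> bool" where
  "has_delta_integral_to_top T g t I \<longleftrightarrow> \<not> bdd_above T \<and>
     (\<exists>J. (\<forall>b\<in>T. t \<le> b \<longrightarrow> has_delta_integral T g t b (J b)) \<and>
          (J \<longlongrightarrow> I) (inf at_top (principal T)))"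

definition has_delta_integral_from_bot ::
    "real set \<Rightarrow> (real \<Rightarrow> 'a::real_normed_vector) \<Rightarrow> real \<Rightarrow> 'a \<Rightarrow> bool" where
  "has_delta_integral_from_bot T g t I \<longleftrightarrow> \<not> bdd_below T \<and>
     (\<exists>J. (\<forall>a\<in>T. a \<le> t \<longrightarrow> has_delta_integral T g a t (J a)) \<and>
          (J \<longlongrightarrow> I) (inf at_bot (principal T)))"

text \<open>
  \<open>e\<^sub>r(t,s)\<close> is the value at \<open>t\<close> of the solution of \<open>y\<^sup>\<Delta> = r y\<close>, \<open>y(s) = 1\<close>. The description is over the
  value rather than over \<open>y\<close>, since a total function \<open>y\<close> is determined only on \<open>T\<close>.
\<close>

definition ts_exp :: "real set \<Rightarrow> (real \<Rightarrow> real) \<Rightarrow> real \<Rightarrow> real \<Rightarrow> real" where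
  "ts_exp T r t s =
     (THE v. \<exists>y. (\<forall>u\<in>T. has_delta_derivative T y (r u * y u) u) \<and> y s = 1 \<and> y t = v)"

definition ominus :: "real set \<Rightarrow> real \<Rightarrow> real \<Rightarrow> real" where
  "ominus T \<alpha> t = - \<alpha> / (1 + graininess T t * \<alpha>)"

definition ts_shift :: "real set \<Rightarrow> real \<Rightarrow> real set" where
  "ts_shift T \<tau> = T \<inter> {t - \<tau> | t. t \<in> T}"

text \<open>Extended-real valued because the suprema may be infinite.\<close>

definition ts_dist :: "real set \<Rightarrow> real set \<Rightarrow> ereal" where
  "ts_dist S S' =
     max (SUP t\<in>S. ereal (infdist t S')) (SUP t\<in>S'. ereal (infdist t S))"

definition almost_periodic_time_scale :: "real set \<Rightarrow> bool" where
  "almost_periodic_time_scale T \<longleftrightarrow> time_scale T \<and>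
     (\<forall>\<epsilon>>0. \<exists>l>0. \<forall>a. \<exists>\<tau>\<in>{a..a + l}.
        ts_shift T \<tau> \<noteq> {} \<and> ts_dist T (ts_shift T \<tau>) < ereal \<epsilon>)"

definition ts_Pi :: "real set \<Rightarrow> real set" where
  "ts_Pi T = {\<tau>. ts_shift T \<tau> \<noteq> {}}"

definition ts_core :: "real set \<Rightarrow> real set" where
  "ts_core T = (\<Inter>\<tau>\<in>ts_Pi T. ts_shift T \<tau>)"

text \<open>
  For \<open>t \<in> ts_core T\<close> and \<open>\<tau> \<in> ts_Pi T\<close> one has \<open>t + \<tau> \<in> T\<close> and \<open>t - \<tau> \<in> ts_core T\<close> (if the core is
  nonempty, then \<open>ts_Pi T\<close> is a closed subgroup of the reals and \<open>T\<close> and \<open>ts_core T\<close> both equal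
  the same coset of it), so no values of \<open>h\<close> off \<open>T\<close> or of \<open>hbar\<close> off the core are used.
\<close>

definition almost_automorphic :: "real set \<Rightarrow> (real \<Rightarrow> 'a::banach) \<Rightarrow> bool" where
  "almost_automorphic T h \<longleftrightarrow> bounded (h ` T) \<and> rd_continuous T h \<and>
     (\<forall>s'::nat \<Rightarrow> real. (\<forall>n. s' n \<in> ts_Pi T) \<longrightarrow>
        (\<exists>r hbar. strict_mono r \<and>
           (\<forall>t\<in>ts_core T. (\<lambda>n. h (t + s' (r n))) \<longlonglongrightarrow> hbar t) \<and>
           (\<forall>t\<in>ts_core T. (\<lambda>n. hbar (t - s' (r n))) \<longlonglongrightarrow> h t)))"

definition mat_almost_automorphic :: "real set \<Rightarrow> (real \<Rightarrow> real^'n^'m) \<Rightarrow> bool" where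
  "mat_almost_automorphic T A \<longleftrightarrow> (\<forall>i j. almost_automorphic T (\<lambda>t. A t $ i $ j))"

definition fundamental_matrix ::
    "real set \<Rightarrow> (real \<Rightarrow> real^'n^'n) \<Rightarrow> (real \<Rightarrow> real^'n^'n) \<Rightarrow> bool" where
  "fundamental_matrix T A X \<longleftrightarrow>
     (\<forall>t\<in>T. has_delta_derivative T X (A t ** X t) t) \<and> (\<forall>t\<in>T. invertible (X t))"

text \<open>The norm on \<^typ>\<open>real^'n^'n\<close> is the Frobenius norm.\<close>

definition exponential_dichotomy ::
    "real set \<Rightarrow> (real \<Rightarrow> real^'n^'n) \<Rightarrow> (real \<Rightarrow> real^'n^'n) \<Rightarrow> real^'n^'n \<Rightarrow> bool" where
  "exponential_dichotomy T A X P \<longleftrightarrow>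
     fundamental_matrix T A X \<and> P ** P = P \<and>
     (\<exists>k \<alpha>. k > 0 \<and> \<alpha> > 0 \<and>
        (\<forall>s\<in>T. \<forall>t\<in>T. t \<ge> fwd_jump T s \<longrightarrow>
           norm (X t ** P ** matrix_inv (X (fwd_jump T s)))
             \<le> k * ts_exp T (ominus T \<alpha>) t (fwd_jump T s)) \<and>
        (\<forall>s\<in>T. \<forall>t\<in>T. t \<le> fwd_jump T s \<longrightarrow>
           norm (X t ** (mat 1 - P) ** matrix_inv (X (fwd_jump T s)))
             \<le> k * ts_exp T (ominus T \<alpha>) (fwd_jump T s) t))"

end

theory Submission
  imports Defs "HOL-Complex_Analysis.Great_Picard"
begin

text \<open>
  Almost periodicity makes \<open>T\<close> relatively dense: every half-open interval of some fixed length
  \<open>m\<close> contains a point of \<open>T\<close>. Hence the graininess is bounded, and the time scale exponential in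
  the dichotomy is dominated by an ordinary exponential \<open>exp (- \<beta> (t - s))\<close>
  (\<open>ts_exp_ominus_le\<close>). Integration on \<open>T\<close> is reduced to integration over the reals by
  continuing each function across a gap by its value at the left end of the gap; for an
  rd-continuous function the result has one-sided limits everywhere, hence is integrable.

  With a delta antiderivative \<open>W\<close> of \<open>inverse X (\<sigma> s) f s\<close>, the dichotomy makes \<open>P W\<close> converge at
  minus infinity and \<open>(1 - P) W\<close> at plus infinity. With \<open>c\<close> the sum of the two limits,
  \<open>x t = X t (W t - c)\<close> is a bounded solution and equals the required difference of improper
  integrals (\<open>bounded_solution_exists\<close>). It is the only bounded solution
  (\<open>bounded_solution_unique\<close>): a bounded solution of the homogeneous equation is \<open>X t c\<close>, and the
  dichotomy forces both components of \<open>c\<close> to vanish.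

  Almost automorphy of \<open>x\<close> is derived from uniqueness. If the core of \<open>T\<close> is empty, there is
  nothing to show beyond boundedness and rd-continuity. Otherwise \<open>T\<close> is a coset of a group of
  reals and is invariant under all translations in question. The translates \<open>x (t + s n)\<close> are
  bounded and equi-Lipschitz, so a subsequence converges to some \<open>xbar\<close>, and a further
  subsequence of \<open>xbar (t - s n)\<close> converges to some \<open>y\<close>. By dominated convergence in the integrated
  equation, \<open>y\<close> is a bounded solution of the original equation, that is \<open>y = x\<close>
  (\<open>bounded_solution_automorphic_along\<close>).

  The two matrix functions are treated directly: limits of matrices with uniformly bounded
  inverses are invertible, and inversion is continuous at them
  (\<open>almost_automorphic_matrix_inv\<close>). The graininess is invariant under the translations, so
  \<open>1 + \<mu> A\<close> is almost automorphic together with \<open>A\<close>.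
\<close>

section \<open>Inverses and norms of real matrices\<close>

lemma norm_matrix_vector_mult_le:
  fixes A :: "real^'n^'m" and x :: "real^'n"
  shows "norm (A *v x) \<le> norm A * norm x"
proof -
  have "norm (A *v x) = L2_set (\<lambda>i. \<bar>A $ i \<bullet> x\<bar>) UNIV"
    by (simp add: norm_vec_def matrix_vector_mult_def inner_vec_def)
  also have "\<dots> \<le> L2_set (\<lambda>i. norm (A $ i) * norm x) UNIV"
    by (intro L2_set_mono) (auto intro: Cauchy_Schwarz_ineq2)
  also have "\<dots> = norm A * norm x"
    by (simp add: norm_vec_def[of A] L2_set_left_distrib)
  finally show ?thesis .
qed

lemma norm_transpose_matrix:
  fixes A :: "real^'n^'m"
  shows "norm (transpose A) = norm A"
  unfolding norm_eq_sqrt_inner inner_vec_def transpose_def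
  by (simp add: sum.swap[of _ "UNIV :: 'n set"])

lemma norm_matrix_matrix_mult_le:
  fixes A :: "real^'n^'m" and B :: "real^'k^'n"
  shows "norm (A ** B) \<le> norm A * norm B"
proof -
  have row: "(A ** B) $ i = transpose B *v (A $ i)" for i
    by (simp add: matrix_matrix_mult_def matrix_vector_mult_def transpose_def vec_eq_iff mult.commute)
  have "norm (A ** B) = L2_set (\<lambda>i. norm (transpose B *v (A $ i))) UNIV"
    by (simp add: norm_vec_def[of "A ** B"] row)
  also have "\<dots> \<le> L2_set (\<lambda>i. norm (A $ i) * norm B) UNIV"
    by (intro L2_set_mono)
       (metis norm_matrix_vector_mult_le norm_transpose_matrix mult.commute, simp)
  also have "\<dots> = norm A * norm B"
    by (simp add: norm_vec_def[of A] L2_set_left_distrib)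
  finally show ?thesis .
qed

lemma bounded_bilinear_matrix_vector_mult:
  "bounded_bilinear ((*v) :: real^'n^'m \<Rightarrow> real^'n \<Rightarrow> real^'m)"
  by (rule bounded_bilinear.intro)
     (auto simp: matrix_vector_mult_add_rdistrib matrix_vector_right_distrib
        scaleR_matrix_vector_assoc matrix_vector_mult_scaleR
        intro!: exI[of _ 1] norm_matrix_vector_mult_le)

lemma bounded_bilinear_matrix_matrix_mult:
  "bounded_bilinear ((**) :: real^'n^'m \<Rightarrow> real^'k^'n \<Rightarrow> real^'k^'m)"
proof (rule bounded_bilinear.intro)
  show "(A + A') ** B = A ** B + A' ** B" for A A' :: "real^'n^'m" and B :: "real^'k^'n"
    by (simp add: matrix_matrix_mult_def vec_eq_iff sum.distrib algebra_simps)
  show "A ** (B + B') = A ** B + A ** B'" for A :: "real^'n^'m" and B B' :: "real^'k^'n"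
    by (rule matrix_add_ldistrib)
  show "(r *\<^sub>R A) ** B = r *\<^sub>R (A ** B)" "A ** (r *\<^sub>R B) = r *\<^sub>R (A ** B)"
    for r and A :: "real^'n^'m" and B :: "real^'k^'n"
    by (simp_all add: matrix_matrix_mult_def vec_eq_iff sum_distrib_left algebra_simps)
  show "\<exists>K. \<forall>(A :: real^'n^'m) (B :: real^'k^'n). norm (A ** B) \<le> norm A * norm B * K"
    by (auto intro!: exI[of _ 1] norm_matrix_matrix_mult_le)
qed

interpretation mvm: bounded_bilinear "(*v) :: real^'n^'m \<Rightarrow> real^'n \<Rightarrow> real^'m"
  by (rule bounded_bilinear_matrix_vector_mult)

interpretation mmm: bounded_bilinear "(**) :: real^'n^'m \<Rightarrow> real^'k^'n \<Rightarrow> real^'k^'m"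
  by (rule bounded_bilinear_matrix_matrix_mult)

lemma matrix_inv_cancel:
  fixes A :: "real^'n^'n"
  assumes "invertible A"
  shows "A ** matrix_inv A = mat 1" "matrix_inv A ** A = mat 1"
    "A *v (matrix_inv A *v x) = x" "matrix_inv A *v (A *v x) = x"
proof -
  have "A ** matrix_inv A = mat 1 \<and> matrix_inv A ** A = mat 1"
    using assms unfolding invertible_def matrix_inv_def by (rule someI_ex)
  then show "A ** matrix_inv A = mat 1" "matrix_inv A ** A = mat 1"
    "A *v (matrix_inv A *v x) = x" "matrix_inv A *v (A *v x) = x"
    by (simp_all add: matrix_vector_mul_assoc)
qed

lemma matrix_inv_diff:
  fixes A B :: "real^'n^'n"
  assumes "invertible A" "invertible B"
  shows "matrix_inv A - matrix_inv B = matrix_inv A ** (B - A) ** matrix_inv B"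
  using assms by (simp add: mmm.diff_left mmm.diff_right matrix_inv_cancel flip: matrix_mul_assoc)

lemma norm_matrix_inv_diff_le:
  fixes A B :: "real^'n^'n"
  assumes "invertible A" "invertible B"
  shows "norm (matrix_inv A - matrix_inv B)
    \<le> norm (matrix_inv A) * norm (B - A) * norm (matrix_inv B)"
  unfolding matrix_inv_diff[OF assms]
  by (meson mult_right_mono norm_ge_zero norm_matrix_matrix_mult_le order_trans)

text \<open>
  The lower bound \<open>norm v \<le> K * norm (A v)\<close> that a bound \<open>K\<close> on the inverses provides survives in
  the limit and makes the limit injective.
\<close>

lemma invertible_limit:
  fixes A :: "'a \<Rightarrow> real^'n^'n"
  assumes "(A \<longlongrightarrow> L) F" and "F \<noteq> bot"
    and bd: "\<forall>\<^sub>F s in F. invertible (A s) \<and> norm (matrix_inv (A s)) \<le> K"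
  shows "invertible L"
proof -
  have low: "norm v \<le> K * norm (L *v v)" for v
  proof (rule tendsto_lowerbound[OF _ _ \<open>F \<noteq> bot\<close>])
    show "((\<lambda>s. K * norm (A s *v v)) \<longlongrightarrow> K * norm (L *v v)) F"
      by (intro tendsto_intros mvm.tendsto assms)
    show "\<forall>\<^sub>F s in F. norm v \<le> K * norm (A s *v v)"
      using bd
    proof eventually_elim
      case (elim s)
      have "norm v = norm (matrix_inv (A s) *v (A s *v v))"
        using elim by (simp add: matrix_inv_cancel)
      also have "\<dots> \<le> norm (matrix_inv (A s)) * norm (A s *v v)"
        by (rule norm_matrix_vector_mult_le)
      also have "\<dots> \<le> K * norm (A s *v v)"
        using elim by (intro mult_right_mono) auto
      finally show ?case .
    qed
  qed
  have "inj ((*v) L)"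
  proof (rule injI)
    fix v w assume "L *v v = L *v w"
    then show "v = w"
      using low[of "v - w"] by (simp add: matrix_vector_mult_diff_distrib)
  qed
  then show ?thesis
    by (metis invertible_left_inverse matrix_left_invertible_injective)
qed

lemma tendsto_matrix_inv_bounded:
  fixes A :: "'a \<Rightarrow> real^'n^'n"
  assumes A: "(A \<longlongrightarrow> L) F" and "invertible L"
    and bd: "\<forall>\<^sub>F s in F. invertible (A s) \<and> norm (matrix_inv (A s)) \<le> K"
  shows "((\<lambda>s. matrix_inv (A s)) \<longlongrightarrow> matrix_inv L) F"
proof (rule LIM_zero_cancel, rule tendsto_0_le[of _ _ _ "K * norm (matrix_inv L)"])
  show "((\<lambda>s. L - A s) \<longlongrightarrow> 0) F"
    using tendsto_diff[OF tendsto_const A, of L] by simp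
  show "\<forall>\<^sub>F s in F. norm (matrix_inv (A s) - matrix_inv L) \<le> norm (L - A s) * (K * norm (matrix_inv L))"
    using bd
  proof eventually_elim
    case (elim s)
    have "norm (matrix_inv (A s) - matrix_inv L)
        \<le> norm (matrix_inv (A s)) * norm (L - A s) * norm (matrix_inv L)"
      using elim \<open>invertible L\<close> by (intro norm_matrix_inv_diff_le) auto
    also have "\<dots> \<le> K * norm (L - A s) * norm (matrix_inv L)"
      using elim by (intro mult_right_mono) auto
    finally show ?case by (simp add: mult_ac)
  qed
qed

text \<open>
  Once \<open>A\<close> is so close to \<open>L\<close> that \<open>norm (L - A) * norm (inverse L) \<le> 1/2\<close>, the identity
  \<open>matrix_inv_diff\<close> bounds \<open>norm (inverse A)\<close> by half of itself plus \<open>norm (inverse L)\<close>.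
\<close>

lemma tendsto_matrix_inv:
  fixes A :: "'a \<Rightarrow> real^'n^'n"
  assumes A: "(A \<longlongrightarrow> L) F" and L: "invertible L" and inv: "\<forall>\<^sub>F s in F. invertible (A s)"
  shows "((\<lambda>s. matrix_inv (A s)) \<longlongrightarrow> matrix_inv L) F"
proof -
  have "((\<lambda>s. norm (L - A s) * norm (matrix_inv L)) \<longlongrightarrow> norm (L - L) * norm (matrix_inv L)) F"
    by (intro tendsto_intros A)
  then have "\<forall>\<^sub>F s in F. norm (L - A s) * norm (matrix_inv L) < 1/2"
    by (rule order_tendstoD) simp
  then have "\<forall>\<^sub>F s in F. invertible (A s) \<and> norm (matrix_inv (A s)) \<le> 2 * norm (matrix_inv L)"
    using inv
  proof eventually_elim
    case (elim s)
    let ?a = "norm (matrix_inv (A s))"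
    have "?a \<le> norm (matrix_inv L) + norm (matrix_inv (A s) - matrix_inv L)"
      by (metis add.commute diff_add_cancel norm_triangle_ineq)
    also have "norm (matrix_inv (A s) - matrix_inv L) \<le> ?a * norm (L - A s) * norm (matrix_inv L)"
      using elim L by (intro norm_matrix_inv_diff_le) auto
    also have "\<dots> \<le> ?a * (1/2)"
      using elim mult_left_mono[of "norm (L - A s) * norm (matrix_inv L)" "1/2" ?a]
      by (simp add: mult.assoc)
    finally show ?case using elim by simp
  qed
  then show ?thesis
    by (rule tendsto_matrix_inv_bounded[OF A L])
qed

section \<open>Integrability of regulated functions\<close>

text \<open>
  By compactness finitely many intervals suffice on each of which the function is, up to an
  error \<open>e\<close>, constant to the left and to the right of a tag; so the function is a uniform limit of
  step functions.
\<close>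

lemma regulated_integrable:
  fixes g :: "real \<Rightarrow> 'a::banach"
  assumes left: "\<And>x. \<exists>l. (g \<longlongrightarrow> l) (at_left x)"
    and right: "\<And>x. \<exists>l. (g \<longlongrightarrow> l) (at_right x)"
  shows "g integrable_on {a..b}"
proof -
  have "g integrable_on cbox a b"
  proof (rule integrable_uniform_limit)
    fix e :: real assume e: "e > 0"
    have "\<exists>d l r. d > 0 \<and> (\<forall>y. x - d < y \<and> y < x \<longrightarrow> norm (g y - l) \<le> e) \<and>
             (\<forall>y. x < y \<and> y < x + d \<longrightarrow> norm (g y - r) \<le> e)" for x
    proof -
      obtain l r where l: "(g \<longlongrightarrow> l) (at_left x)" and r: "(g \<longlongrightarrow> r) (at_right x)"
        using left right by blast
      obtain d1 where d1: "d1 < x" "\<And>y. d1 < y \<Longrightarrow> y < x \<Longrightarrow> dist (g y) l < e"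
        using tendstoD[OF l e] unfolding eventually_at_left_field by auto
      obtain d2 where d2: "d2 > x" "\<And>y. x < y \<Longrightarrow> y < d2 \<Longrightarrow> dist (g y) r < e"
        using tendstoD[OF r e] unfolding eventually_at_right_field by auto
      have "norm (g y - l) \<le> e" if "x - min (x - d1) (d2 - x) < y" "y < x" for y
        using d1(2)[of y] that by (simp add: dist_norm min_def split: if_splits)
      moreover have "norm (g y - r) \<le> e" if "x < y" "y < x + min (x - d1) (d2 - x)" for y
        using d2(2)[of y] that by (simp add: dist_norm min_def split: if_splits)
      moreover have "min (x - d1) (d2 - x) > 0"
        using d1(1) d2(1) by simp
      ultimately show ?thesis
        by blast
    qed
    then obtain d l r where d: "\<And>x::real. d x > 0"
      and l: "\<And>x y. x - d x < y \<Longrightarrow> y < x \<Longrightarrow> norm (g y - l x) \<le> e"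
      and r: "\<And>x y. x < y \<Longrightarrow> y < x + d x \<Longrightarrow> norm (g y - r x) \<le> e"
      by metis
    have "gauge (\<lambda>x. ball x (d x))"
      using d by (intro gauge_ball_dependent) auto
    then obtain p where p: "p tagged_division_of cbox a b" "(\<lambda>x. ball x (d x)) fine p"
      by (rule fine_division_exists)
    have "\<forall>i\<in>snd ` p. \<exists>h. (\<forall>y\<in>i. norm (g y - h y) \<le> e) \<and> h integrable_on i"
    proof clarsimp
      fix x K assume xK: "(x, K) \<in> p"
      obtain u v where K: "K = cbox u v"
        using xK p(1) by blast
      have x: "u \<le> x" "x \<le> v"
        using xK p(1) K by auto
      have sub: "K \<subseteq> ball x (d x)"
        using p(2) xK by (auto simp: fine_def)
      define h where "h y = (if y < x then l x else if y = x then g x else r x)" for y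
      have "h integrable_on {u..x}"
        by (rule integrable_spike_finite[of "{x}" _ _ "\<lambda>_. l x"]) (auto simp: h_def)
      moreover have "h integrable_on {x..v}"
        by (rule integrable_spike_finite[of "{x}" _ _ "\<lambda>_. r x"]) (auto simp: h_def)
      ultimately have "h integrable_on K"
        using Henstock_Kurzweil_Integration.integrable_combine[OF x] by (simp add: K)
      moreover have "norm (g y - h y) \<le> e" if "y \<in> K" for y
      proof -
        have "\<bar>x - y\<bar> < d x" using sub that by (auto simp: dist_real_def)
        then show ?thesis
          using l[of x y] r[of x y] e by (cases y x rule: linorder_cases) (auto simp: h_def)
      qed
      ultimately show "\<exists>h. (\<forall>y\<in>K. norm (g y - h y) \<le> e) \<and> h integrable_on K"
        by blast
    qed
    from approximable_on_division[OF less_imp_le[OF e] division_of_tagged_division[OF p(1)] this]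
    show "\<exists>h. (\<forall>x\<in>cbox a b. norm (g x - h x) \<le> e) \<and> h integrable_on cbox a b"
      by metis
  qed
  then show ?thesis by simp
qed

section \<open>Right-dense continuity\<close>

lemma rd_continuousI_continuous:
  assumes "\<And>t. t \<in> T \<Longrightarrow> continuous (at t within T) f"
  shows "rd_continuous T f"
  unfolding rd_continuous_def
  using assms by (meson Int_lower1 continuous_within tendsto_within_subset)

lemma rd_continuous_const: "rd_continuous T (\<lambda>_. c)"
  by (rule rd_continuousI_continuous) simp

lemma rd_continuous_bilinear:
  assumes "bounded_bilinear b" "rd_continuous T f" "rd_continuous T g"
  shows "rd_continuous T (\<lambda>t. b (f t) (g t))"
  unfolding rd_continuous_def
proof (intro conjI ballI impI)
  fix t assume "t \<in> T" "bwd_jump T t = t"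
  then obtain l k where "(f \<longlongrightarrow> l) (at t within T \<inter> {..<t})" "(g \<longlongrightarrow> k) (at t within T \<inter> {..<t})"
    using assms(2,3) unfolding rd_continuous_def by blast
  then show "\<exists>l. ((\<lambda>t. b (f t) (g t)) \<longlongrightarrow> l) (at t within T \<inter> {..<t})"
    using bounded_bilinear.tendsto[OF assms(1)] by blast
next
  fix t assume "t \<in> T" "fwd_jump T t = t"
  then show "continuous (at t within T) (\<lambda>t. b (f t) (g t))"
    using assms(2,3) by (intro bounded_bilinear.continuous[OF assms(1)]) (auto simp: rd_continuous_def)
qed

lemma rd_continuous_linear:
  assumes "bounded_linear b" "rd_continuous T f"
  shows "rd_continuous T (\<lambda>t. b (f t))"
  unfolding rd_continuous_def
proof (intro conjI ballI impI)
  fix t assume "t \<in> T" "bwd_jump T t = t"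
  then obtain l where "(f \<longlongrightarrow> l) (at t within T \<inter> {..<t})"
    using assms(2) unfolding rd_continuous_def by blast
  then show "\<exists>l. ((\<lambda>t. b (f t)) \<longlongrightarrow> l) (at t within T \<inter> {..<t})"
    using bounded_linear.tendsto[OF assms(1)] by blast
qed (use assms bounded_linear.continuous[OF assms(1)] in \<open>auto simp: rd_continuous_def\<close>)

lemma rd_continuous_add:
  assumes "rd_continuous T f" "rd_continuous T g"
  shows "rd_continuous T (\<lambda>t. f t + g t)"
  unfolding rd_continuous_def
proof (intro conjI ballI impI)
  fix t assume "t \<in> T" "bwd_jump T t = t"
  then obtain l k where "(f \<longlongrightarrow> l) (at t within T \<inter> {..<t})" "(g \<longlongrightarrow> k) (at t within T \<inter> {..<t})"
    using assms unfolding rd_continuous_def by blast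
  then show "\<exists>l. ((\<lambda>t. f t + g t) \<longlongrightarrow> l) (at t within T \<inter> {..<t})"
    using tendsto_add by blast
qed (use assms in \<open>auto simp: rd_continuous_def intro: continuous_add\<close>)

lemma rd_continuous_vec_iff:
  fixes f :: "real \<Rightarrow> ('a::real_normed_vector)^'n"
  shows "rd_continuous T f \<longleftrightarrow> (\<forall>i. rd_continuous T (\<lambda>t. f t $ i))"
proof
  assume "rd_continuous T f"
  then show "\<forall>i. rd_continuous T (\<lambda>t. f t $ i)"
    by (simp add: rd_continuous_linear[OF bounded_linear_vec_nth])
next
  assume comp: "\<forall>i. rd_continuous T (\<lambda>t. f t $ i)"
  show "rd_continuous T f"
    unfolding rd_continuous_def
  proof (intro conjI ballI impI)
    fix t assume "t \<in> T" "fwd_jump T t = t"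
    then show "continuous (at t within T) f"
      using comp unfolding rd_continuous_def continuous_within by (auto intro: vec_tendstoI)
  next
    fix t assume "t \<in> T" "bwd_jump T t = t"
    then have "\<forall>i. \<exists>l. ((\<lambda>t. f t $ i) \<longlongrightarrow> l) (at t within T \<inter> {..<t})"
      using comp unfolding rd_continuous_def by blast
    then obtain l where "\<forall>i. ((\<lambda>t. f t $ i) \<longlongrightarrow> l i) (at t within T \<inter> {..<t})"
      by metis
    then have "(f \<longlongrightarrow> (\<chi> i. l i)) (at t within T \<inter> {..<t})"
      by (intro vec_tendstoI) simp
    then show "\<exists>l. (f \<longlongrightarrow> l) (at t within T \<inter> {..<t})" ..
  qed
qed

section \<open>Relatively dense time scales\<close>

text \<open>
  The existence and uniqueness arguments use almost periodicity through the following
  consequence: \<open>T\<close> is unbounded in both directions and its graininess is at most \<open>m\<close>.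
\<close>

locale relatively_dense_time_scale =
  fixes T :: "real set" and m :: real
  assumes closed: "closed T"
    and relatively_dense: "\<And>u. \<exists>s\<in>T. u < s \<and> s \<le> u + m"
begin

abbreviation \<sigma> where "\<sigma> \<equiv> fwd_jump T"
abbreviation \<mu> where "\<mu> \<equiv> graininess T"

lemma m_pos: "m > 0"
  using relatively_dense[of 0] by auto

lemma not_bdd: "\<not> bdd_above T" "\<not> bdd_below T"
proof -
  show "\<not> bdd_above T"
    using relatively_dense unfolding bdd_above_def by (meson not_less)
  show "\<not> bdd_below T"
  proof
    assume "bdd_below T"
    then obtain B where "\<And>s. s \<in> T \<Longrightarrow> B \<le> s" by (auto simp: bdd_below_def)
    moreover obtain s where "s \<in> T" "s \<le> B - m - 1 + m"
      using relatively_dense by blast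
    ultimately show False by force
  qed
qed

lemma sigma_eq: "\<sigma> t = Inf {s \<in> T. t < s}"
  using relatively_dense[of t] by (auto simp: fwd_jump_def)

lemma sigma_le: "s \<in> T \<Longrightarrow> t < s \<Longrightarrow> \<sigma> t \<le> s"
  unfolding sigma_eq by (rule cInf_lower) (auto intro: bdd_belowI[of _ t])

lemma sigma_in: "\<sigma> t \<in> T"
proof -
  have "\<sigma> t \<in> closure {s \<in> T. t < s}"
    unfolding sigma_eq using relatively_dense[of t]
    by (intro closure_contains_Inf) (auto intro: bdd_belowI[of _ t])
  also have "\<dots> \<subseteq> T"
    by (rule closure_minimal) (auto simp: closed)
  finally show ?thesis .
qed

lemma sigma_ge: "t \<le> \<sigma> t"
  unfolding sigma_eq using relatively_dense[of t] by (intro cInf_greatest) auto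

lemma sigma_le_add: "\<sigma> t \<le> t + m"
  using relatively_dense[of t] sigma_le by force

lemma graininess_bounds: "0 \<le> \<mu> t" "\<mu> t \<le> m"
  using sigma_ge[of t] sigma_le_add[of t] by (auto simp: graininess_def)

lemma sigma_eq_add_graininess: "\<sigma> t = t + \<mu> t"
  by (simp add: graininess_def)

lemma right_dense_point:
  assumes "\<sigma> t = t" "e > 0"
  obtains s where "s \<in> T" "t < s" "s < t + e"
proof (rule ccontr)
  assume "\<not> thesis"
  then have "t + e \<le> Inf {s \<in> T. t < s}"
    using relatively_dense[of t] that by (intro cInf_greatest) (auto simp: not_less[symmetric])
  with assms show False by (simp add: sigma_eq)
qed

lemma tendsto_sigma_right_dense:
  assumes "t \<in> T" "\<sigma> t = t"
  shows "(\<sigma> \<longlongrightarrow> t) (at t within T)"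
  unfolding tendsto_iff eventually_at
proof (intro allI impI)
  fix e :: real assume "e > 0"
  then obtain s where s: "s \<in> T" "t < s" "s < t + e"
    using right_dense_point[OF assms(2)] by blast
  have "dist (\<sigma> x) t < e" if "x \<in> T" "x \<noteq> t" "dist x t < s - t" for x
  proof (cases "x < t")
    case True
    then show ?thesis
      using sigma_le[of t x] sigma_ge[of x] assms(1) that s by (auto simp: dist_real_def)
  next
    case False
    then show ?thesis
      using sigma_le[of s x] sigma_ge[of x] that s by (auto simp: dist_real_def)
  qed
  then show "\<exists>d>0. \<forall>x\<in>T. x \<noteq> t \<and> dist x t < d \<longrightarrow> dist (\<sigma> x) t < e"
    using s by (intro exI[of _ "s - t"]) auto
qed

lemma tendsto_sigma_left:
  assumes "t \<in> T"
  shows "(\<sigma> \<longlongrightarrow> t) (at t within T \<inter> {..<t})"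
proof (rule tendsto_sandwich)
  show "((\<lambda>x. x) \<longlongrightarrow> t) (at t within T \<inter> {..<t})" by (rule tendsto_ident_at)
  show "\<forall>\<^sub>F x in at t within T \<inter> {..<t}. x \<le> \<sigma> x"
    by (simp add: sigma_ge)
  show "\<forall>\<^sub>F x in at t within T \<inter> {..<t}. \<sigma> x \<le> t"
    using sigma_le[OF assms] by (auto simp: eventually_at_filter)
qed auto

lemma rd_continuous_comp_sigma:
  assumes F: "\<And>t. t \<in> T \<Longrightarrow> continuous (at t within T) F"
  shows "rd_continuous T (\<lambda>t. F (\<sigma> t))"
  unfolding rd_continuous_def
proof (intro conjI ballI impI)
  fix t assume t: "t \<in> T" "\<sigma> t = t"
  then show "continuous (at t within T) (\<lambda>t. F (\<sigma> t))"
    unfolding continuous_within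
    using continuous_within_tendsto_compose[OF F[OF t(1)] _ tendsto_sigma_right_dense[OF t]]
    by (simp add: sigma_in)
next
  fix t assume t: "t \<in> T"
  show "\<exists>l. ((\<lambda>t. F (\<sigma> t)) \<longlongrightarrow> l) (at t within T \<inter> {..<t})"
    using continuous_within_tendsto_compose[OF F[OF t] _ tendsto_sigma_left[OF t]]
    by (auto simp: sigma_in)
qed

lemma rd_continuous_graininess_comp:
  assumes F: "continuous (at 0) (F :: real \<Rightarrow> 'a::real_normed_vector)"
  shows "rd_continuous T (\<lambda>t. F (\<mu> t))"
proof -
  have lim: "((\<lambda>t. F (\<mu> t)) \<longlongrightarrow> F 0) (at t within S)" if "(\<sigma> \<longlongrightarrow> t) (at t within S)" for t S
  proof (rule continuous_within_tendsto_compose[OF F])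
    show "(\<mu> \<longlongrightarrow> 0) (at t within S)"
      using tendsto_diff[OF that tendsto_ident_at] by (simp add: graininess_def[abs_def])
  qed auto
  show ?thesis
    unfolding rd_continuous_def continuous_within
    using lim tendsto_sigma_right_dense tendsto_sigma_left
    by (metis diff_self graininess_def)
qed

text \<open>
  Integration on \<open>T\<close> is integration on the reals once a function on \<open>T\<close> is continued across each
  gap by its value at the left end of the gap; \<open>left_point u\<close> is the point of \<open>T\<close> that gives the
  value at \<open>u\<close>.
\<close>

definition left_point :: "real \<Rightarrow> real" where
  "left_point u = Sup {s \<in> T. s \<le> u}"

lemma nonempty_below: "{s \<in> T. s \<le> u} \<noteq> {}"
proof -
  obtain s where "s \<in> T" "s \<le> u - m + m"
    using relatively_dense by blast
  then show ?thesis by auto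
qed

lemma left_point_in: "left_point u \<in> T" and left_point_le: "left_point u \<le> u"
proof -
  have "left_point u \<in> {s \<in> T. s \<le> u}"
    unfolding left_point_def
  proof (rule closed_contains_Sup[OF nonempty_below])
    have "{s \<in> T. s \<le> u} = T \<inter> {..u}" by auto
    then show "closed {s \<in> T. s \<le> u}" by (simp add: closed closed_Int)
  qed (auto intro: bdd_aboveI[of _ u])
  then show "left_point u \<in> T" "left_point u \<le> u" by auto
qed

lemma left_point_ge: "s \<in> T \<Longrightarrow> s \<le> u \<Longrightarrow> s \<le> left_point u"
  unfolding left_point_def by (rule cSup_upper) (auto intro: bdd_aboveI[of _ u])

lemma left_point_unique:
  assumes "s \<in> T" "s \<le> u" "\<And>r. r \<in> T \<Longrightarrow> r \<le> u \<Longrightarrow> r \<le> s"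
  shows "left_point u = s"
  using assms left_point_ge[of s u] left_point_in[of u] left_point_le[of u] by (simp add: antisym)

lemma le_sigma_left_point: "u \<le> \<sigma> (left_point u)"
proof (rule ccontr)
  assume "\<not> ?thesis"
  then have gt: "\<sigma> (left_point u) < u" by simp
  then have eq: "\<sigma> (left_point u) = left_point u"
    using sigma_ge left_point_ge[OF sigma_in] by (meson antisym less_imp_le)
  obtain s where "s \<in> T" "left_point u < s" "s < left_point u + (u - left_point u)"
    using right_dense_point[OF eq, of "u - left_point u"] gt eq by auto
  then show False
    using left_point_ge[of s u] by auto
qed

text \<open>
  On the open side of a gap \<open>left_point\<close> is locally constant; at a point approached by \<open>T\<close> it
  tends to that point through \<open>T\<close>.
\<close>

lemma rd_continuous_regulated:
  assumes h: "rd_continuous T h"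
  shows "\<exists>l. ((\<lambda>u. h (left_point u)) \<longlongrightarrow> l) (at_left u)"
    and "\<exists>l. ((\<lambda>u. h (left_point u)) \<longlongrightarrow> l) (at_right u)"
proof -
  show "\<exists>l. ((\<lambda>u. h (left_point u)) \<longlongrightarrow> l) (at_left u)"
  proof (cases "\<exists>d<u. \<forall>s\<in>T. \<not> (d < s \<and> s < u)")
    case True
    then obtain d where d: "d < u" "\<And>s. s \<in> T \<Longrightarrow> \<not> (d < s \<and> s < u)" by blast
    have "left_point v = left_point d" if "d < v" "v < u" for v
    proof (rule left_point_unique)
      show "left_point d \<le> v" using left_point_le[of d] that by simp
      show "r \<le> left_point d" if "r \<in> T" "r \<le> v" for r
        using d(2)[of r] left_point_ge[of r d] that \<open>v < u\<close> by force
    qed (rule left_point_in)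
    then have "\<forall>\<^sub>F v in at_left u. h (left_point v) = h (left_point d)"
      using d(1) unfolding eventually_at_left_field by (intro exI[of _ d]) auto
    then show ?thesis
      by (intro exI) (rule tendsto_eventually)
  next
    case False
    then have acc: "\<exists>s\<in>T. d < s \<and> s < u" if "d < u" for d
      using that by blast
    have "u \<in> closure T"
      unfolding closure_approachable
    proof (intro allI impI)
      fix e :: real assume "e > 0"
      then obtain s where "s \<in> T" "u - e < s" "s < u"
        using acc[of "u - e"] by auto
      then show "\<exists>y\<in>T. dist y u < e"
        by (intro bexI[of _ s]) (auto simp: dist_real_def)
    qed
    then have u: "u \<in> T"
      using closed closure_closed by blast
    have "Sup {s \<in> T. s < u} = u"
    proof (rule cSup_eq_non_empty)
      show "{s \<in> T. s < u} \<noteq> {}"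
        using acc[of "u - 1"] by auto
      show "u \<le> y" if "\<And>x. x \<in> {s \<in> T. s < u} \<Longrightarrow> x \<le> y" for y
        using acc[of y] that by force
    qed auto
    then have "bwd_jump T u = u"
      by (simp add: bwd_jump_def)
    then obtain l where l: "(h \<longlongrightarrow> l) (at u within T \<inter> {..<u})"
      using h u unfolding rd_continuous_def by blast
    have "filterlim left_point (at u within T \<inter> {..<u}) (at_left u)"
      unfolding filterlim_at
    proof
      show "\<forall>\<^sub>F v in at_left u. left_point v \<in> T \<inter> {..<u} \<and> left_point v \<noteq> u"
        using left_point_in le_less_trans[OF left_point_le]
        by (auto simp: eventually_at_filter intro!: always_eventually)
      show "(left_point \<longlongrightarrow> u) (at_left u)"
        unfolding tendsto_iff
      proof (intro allI impI)
        fix e :: real assume "e > 0"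
        then obtain s where s: "s \<in> T" "u - e < s" "s < u"
          using acc[of "u - e"] by auto
        have "dist (left_point v) u < e" if "s < v" "v < u" for v
          using left_point_ge[of s v] left_point_le[of v] s that by (auto simp: dist_real_def)
        then show "\<forall>\<^sub>F v in at_left u. dist (left_point v) u < e"
          unfolding eventually_at_left_field using s by (intro exI[of _ s]) auto
      qed
    qed
    then show ?thesis
      by (intro exI) (rule filterlim_compose[OF l])
  qed
next
  show "\<exists>l. ((\<lambda>u. h (left_point u)) \<longlongrightarrow> l) (at_right u)"
  proof (cases "\<exists>d>u. \<forall>s\<in>T. \<not> (u < s \<and> s < d)")
    case True
    then obtain d where d: "u < d" "\<And>s. s \<in> T \<Longrightarrow> \<not> (u < s \<and> s < d)" by blast
    have "left_point v = left_point u" if "u < v" "v < d" for v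
    proof (rule left_point_unique)
      show "left_point u \<le> v" using left_point_le[of u] that by simp
      show "r \<le> left_point u" if "r \<in> T" "r \<le> v" for r
        using d(2)[of r] left_point_ge[of r u] that \<open>v < d\<close> by force
    qed (rule left_point_in)
    then have "\<forall>\<^sub>F v in at_right u. h (left_point v) = h (left_point u)"
      using d(1) unfolding eventually_at_right_field by (intro exI[of _ d]) auto
    then show ?thesis
      by (intro exI) (rule tendsto_eventually)
  next
    case False
    then have acc: "\<exists>s\<in>T. u < s \<and> s < d" if "u < d" for d
      using that by blast
    have "u \<in> closure T"
      unfolding closure_approachable
    proof (intro allI impI)
      fix e :: real assume "e > 0"
      then obtain s where "s \<in> T" "u < s" "s < u + e"
        using acc[of "u + e"] by auto
      then show "\<exists>y\<in>T. dist y u < e"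
        by (intro bexI[of _ s]) (auto simp: dist_real_def)
    qed
    then have u: "u \<in> T"
      using closed closure_closed by blast
    have "\<not> u < \<sigma> u"
      using acc sigma_le by (meson not_le)
    then have "\<sigma> u = u"
      using sigma_ge[of u] by simp
    then have cont: "continuous (at u within T) h"
      using h u unfolding rd_continuous_def by blast
    have "(left_point \<longlongrightarrow> u) (at_right u)"
    proof (rule tendsto_sandwich)
      show "\<forall>\<^sub>F v in at_right u. u \<le> left_point v"
        unfolding eventually_at_filter using left_point_ge[OF u] by (auto intro!: always_eventually)
      show "\<forall>\<^sub>F v in at_right u. left_point v \<le> v"
        by (simp add: left_point_le)
    qed (rule tendsto_const, rule tendsto_ident_at)
    then show ?thesis
      using continuous_within_tendsto_compose[OF cont, of left_point "at_right u"]
      by (auto simp: left_point_in)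
  qed
qed

lemma rd_continuous_integrable:
  fixes h :: "real \<Rightarrow> 'a::banach"
  assumes "rd_continuous T h"
  shows "(\<lambda>u. h (left_point u)) integrable_on {a..b}"
  by (intro regulated_integrable rd_continuous_regulated assms)

end

section \<open>Delta derivatives\<close>

lemma has_vector_derivative_within_iff_quotient:
  "(f has_vector_derivative D) (at t within S) \<longleftrightarrow>
    ((\<lambda>s. (f s - f t) /\<^sub>R (s - t)) \<longlongrightarrow> D) (at t within S)"
proof -
  have "norm (f s - f t - (s - t) *\<^sub>R D) / norm (s - t) = norm ((f s - f t) /\<^sub>R (s - t) - D)"
    if "s \<noteq> t" for s
  proof -
    have "(f s - f t) /\<^sub>R (s - t) - D = (f s - f t - (s - t) *\<^sub>R D) /\<^sub>R (s - t)"
      using that by (simp add: scaleR_diff_right)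
    then show ?thesis by (simp add: divide_inverse mult.commute)
  qed
  then have "((\<lambda>s. norm (f s - f t - (s - t) *\<^sub>R D) / norm (s - t)) \<longlongrightarrow> 0) (at t within S) \<longleftrightarrow>
      ((\<lambda>s. norm ((f s - f t) /\<^sub>R (s - t) - D)) \<longlongrightarrow> 0) (at t within S)"
    by (intro tendsto_cong) (simp add: eventually_at_filter)
  then show ?thesis
    by (simp add: has_vector_derivative_def has_derivative_iff_norm bounded_linear_scaleR_left
        tendsto_norm_zero_iff LIM_zero_iff)
qed

context relatively_dense_time_scale
begin

text \<open>
  At a right-scattered point the delta derivative is a difference quotient together with
  continuity, at a right-dense point it is the derivative within \<open>T\<close>. This splits each
  differentiation rule into an algebraic identity and the corresponding classical rule.
\<close>

lemma has_delta_derivative_iff: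
  assumes t: "t \<in> T"
  shows "has_delta_derivative T f D t \<longleftrightarrow>
    f (\<sigma> t) - f t = \<mu> t *\<^sub>R D \<and> continuous (at t within T) f \<and>
    (\<sigma> t = t \<longrightarrow> (f has_vector_derivative D) (at t within T))"
    (is "_ \<longleftrightarrow> ?jump \<and> ?cont \<and> ?dense")
proof
  assume D: "has_delta_derivative T f D t"
  have jump: ?jump
  proof -
    have "norm (f (\<sigma> t) - f t - \<mu> t *\<^sub>R D) \<le> 0 + e" if "e > 0" for e
    proof -
      have "e / (m + 1) > 0" using that m_pos by simp
      then have "norm (f (\<sigma> t) - f t - \<mu> t *\<^sub>R D) \<le> e / (m + 1) * \<bar>\<mu> t\<bar>"
        using D t unfolding has_delta_derivative_def graininess_def by (metis abs_zero diff_self)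
      also have "\<dots> \<le> e / (m + 1) * (m + 1)"
        using graininess_bounds[of t] that m_pos by (intro mult_left_mono) auto
      finally show ?thesis using m_pos by simp
    qed
    then have "norm (f (\<sigma> t) - f t - \<mu> t *\<^sub>R D) \<le> 0"
      by (rule field_le_epsilon)
    then show ?thesis by simp
  qed
  moreover have ?cont
    unfolding continuous_within
  proof (rule LIM_zero_cancel, rule tendsto_0_le[of _ _ _ 1])
    have small: "\<forall>\<^sub>F s in at t within T. norm (f s - f t + (t - s) *\<^sub>R D) < e" if "e > 0" for e
    proof -
      \<comment> \<open>\<open>\<sigma> t - s\<close> is at most \<open>m + 1\<close> in absolute value for \<open>s\<close> within distance 1 of \<open>t\<close>\<close>
      have "e / (m + 2) > 0" using that m_pos by simp
      then obtain d where d: "d > 0" "\<And>s. s \<in> T \<Longrightarrow> \<bar>s - t\<bar> < d \<Longrightarrow>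
          norm (f (\<sigma> t) - f s - (\<sigma> t - s) *\<^sub>R D) \<le> e / (m + 2) * \<bar>\<sigma> t - s\<bar>"
        using D unfolding has_delta_derivative_def by blast
      have "norm (f s - f t + (t - s) *\<^sub>R D) < e" if s: "s \<in> T" "dist s t < min d 1" for s
      proof -
        have "f s - f t + (t - s) *\<^sub>R D = - (f (\<sigma> t) - f s - (\<sigma> t - s) *\<^sub>R D)"
          using jump by (simp add: sigma_eq_add_graininess algebra_simps)
        then have "norm (f s - f t + (t - s) *\<^sub>R D) \<le> e / (m + 2) * \<bar>\<sigma> t - s\<bar>"
          using d(2)[of s] s by (simp only: norm_minus_cancel) (simp add: dist_real_def)
        also have "\<dots> < e / (m + 2) * (m + 2)"
          using graininess_bounds[of t] s \<open>e / (m + 2) > 0\<close>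
          by (intro mult_strict_left_mono) (auto simp: dist_real_def sigma_eq_add_graininess)
        finally show ?thesis using m_pos by simp
      qed
      then show ?thesis
        unfolding eventually_at using d(1) by (intro exI[of _ "min d 1"]) auto
    qed
    have "((\<lambda>s. (f s - f t + (t - s) *\<^sub>R D) - (t - s) *\<^sub>R D) \<longlongrightarrow> 0 - (t - t) *\<^sub>R D) (at t within T)"
      by (intro tendsto_diff[OF tendstoI] tendsto_intros) (simp add: small)
    then show "((\<lambda>s. f s - f t) \<longlongrightarrow> 0) (at t within T)" by simp
  qed simp
  moreover have ?dense
    using D by (auto simp: has_delta_derivative_def has_vector_derivative_def has_derivative_within_alt
        bounded_linear_scaleR_left norm_minus_commute abs_minus_commute algebra_simps)
  ultimately show "?jump \<and> ?cont \<and> ?dense" by blast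
next
  assume R: "?jump \<and> ?cont \<and> ?dense"
  show "has_delta_derivative T f D t"
    unfolding has_delta_derivative_def
  proof (intro allI impI)
    fix e :: real assume e: "e > 0"
    show "\<exists>d>0. \<forall>s\<in>T. \<bar>s - t\<bar> < d \<longrightarrow>
        norm (f (\<sigma> t) - f s - (\<sigma> t - s) *\<^sub>R D) \<le> e * \<bar>\<sigma> t - s\<bar>"
    proof (cases "\<sigma> t = t")
      case True
      then obtain d where d: "d > 0" "\<And>s. s \<in> T \<Longrightarrow> norm (s - t) < d \<Longrightarrow>
          norm (f s - f t - (s - t) *\<^sub>R D) \<le> e * norm (s - t)"
        using R e unfolding has_vector_derivative_def has_derivative_within_alt by blast
      have "norm (f t - f s - (t - s) *\<^sub>R D) \<le> e * \<bar>t - s\<bar>" if "s \<in> T" "\<bar>s - t\<bar> < d" for s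
      proof -
        have "f t - f s - (t - s) *\<^sub>R D = - (f s - f t - (s - t) *\<^sub>R D)"
          by (simp add: algebra_simps)
        then show ?thesis
          using d(2)[of s] that by (simp only: norm_minus_cancel) (simp add: abs_minus_commute)
      qed
      then show ?thesis
        using d(1) True by auto
    next
      case False
      then have pos: "\<mu> t > 0"
        using sigma_ge[of t] by (simp add: graininess_def)
      have "((\<lambda>s. norm (f s - f t) + \<bar>s - t\<bar> * norm D) \<longlongrightarrow> norm (f t - f t) + \<bar>t - t\<bar> * norm D) (at t within T)"
        using R by (intro tendsto_intros) (simp add: continuous_within)
      then have "\<forall>\<^sub>F s in at t within T. norm (f s - f t) + \<bar>s - t\<bar> * norm D < e * (\<mu> t / 2)"
        using e pos by (intro order_tendstoD(2)[where y = "norm (f t - f t) + \<bar>t - t\<bar> * norm D"]) auto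
      then obtain d where d: "d > 0" "\<And>s. s \<in> T \<Longrightarrow> s \<noteq> t \<Longrightarrow> dist s t < d \<Longrightarrow>
          norm (f s - f t) + \<bar>s - t\<bar> * norm D < e * (\<mu> t / 2)"
        unfolding eventually_at by auto
      have "norm (f (\<sigma> t) - f s - (\<sigma> t - s) *\<^sub>R D) \<le> e * \<bar>\<sigma> t - s\<bar>"
        if s: "s \<in> T" "\<bar>s - t\<bar> < min d (\<mu> t / 2)" for s
      proof (cases "s = t")
        case True
        have "f (\<sigma> t) - f t - (\<sigma> t - t) *\<^sub>R D = 0"
          using R by (simp add: graininess_def)
        then show ?thesis using True e by simp
      next
        case False
        have "f (\<sigma> t) - f s - (\<sigma> t - s) *\<^sub>R D = - (f s - f t) + (s - t) *\<^sub>R D"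
          using R by (simp add: sigma_eq_add_graininess algebra_simps)
        also have "norm \<dots> \<le> norm (f s - f t) + \<bar>s - t\<bar> * norm D"
          using norm_triangle_ineq[of "- (f s - f t)" "(s - t) *\<^sub>R D"]
          by (simp only: norm_minus_cancel norm_scaleR real_norm_def)
        also have "\<dots> \<le> e * (\<mu> t / 2)"
          using d(2)[of s] s False by (simp add: dist_real_def)
        also have "\<dots> \<le> e * \<bar>\<sigma> t - s\<bar>"
          using s e by (intro mult_left_mono) (auto simp: sigma_eq_add_graininess abs_if split: if_splits)
        finally show ?thesis .
      qed
      then show ?thesis
        using d(1) pos by (intro exI[of _ "min d (\<mu> t / 2)"]) auto
    qed
  qed
qed

lemma has_delta_derivative_continuous:
  "t \<in> T \<Longrightarrow> has_delta_derivative T f D t \<Longrightarrow> continuous (at t within T) f"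
  by (simp add: has_delta_derivative_iff)

lemma has_delta_derivative_sigma:
  "t \<in> T \<Longrightarrow> has_delta_derivative T f D t \<Longrightarrow> f (\<sigma> t) = f t + \<mu> t *\<^sub>R D"
  by (simp add: has_delta_derivative_iff algebra_simps)

lemma has_delta_derivative_diff:
  assumes "t \<in> T" "has_delta_derivative T f D t" "has_delta_derivative T g E t"
  shows "has_delta_derivative T (\<lambda>s. f s - g s) (D - E) t"
  using assms
  by (auto simp: has_delta_derivative_iff algebra_simps
      intro: continuous_diff has_vector_derivative_diff)

lemma has_delta_derivative_const: "t \<in> T \<Longrightarrow> has_delta_derivative T (\<lambda>_. c) 0 t"
  by (simp add: has_delta_derivative_iff)

lemma has_delta_derivative_bilinear:
  assumes b: "bounded_bilinear b" and t: "t \<in> T"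
    and f: "has_delta_derivative T f D t" and g: "has_delta_derivative T g E t"
  shows "has_delta_derivative T (\<lambda>s. b (f s) (g s)) (b (f (\<sigma> t)) E + b D (g t)) t"
proof -
  interpret b: bounded_bilinear b by (rule b)
  have "b (f (\<sigma> t)) (g (\<sigma> t)) - b (f t) (g t) = \<mu> t *\<^sub>R (b (f (\<sigma> t)) E + b D (g t))"
  proof -
    have "b (f (\<sigma> t)) (g (\<sigma> t)) - b (f t) (g t)
        = b (f (\<sigma> t)) (g (\<sigma> t) - g t) + b (f (\<sigma> t) - f t) (g t)"
      by (simp add: b.diff_left b.diff_right)
    then show ?thesis
      using f g by (simp add: has_delta_derivative_iff[OF t] b.scaleR_left b.scaleR_right algebra_simps)
  qed
  then show ?thesis
    using f g
    by (auto simp: has_delta_derivative_iff[OF t] intro: b.continuous b.has_vector_derivative)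
qed

lemma has_delta_derivative_linear:
  assumes b: "bounded_linear b" and t: "t \<in> T" and f: "has_delta_derivative T f D t"
  shows "has_delta_derivative T (\<lambda>s. b (f s)) (b D) t"
proof -
  interpret b: bounded_linear b by (rule b)
  show ?thesis
    using f
    by (auto simp: has_delta_derivative_iff[OF t] b.scaleR simp flip: b.diff
        intro: b.continuous b.has_vector_derivative)
qed

text \<open>
  \<open>inverse X (\<sigma> t) - inverse X s = - inverse X (\<sigma> t) (X (\<sigma> t) - X s) inverse X s\<close>, where the
  middle factor is \<open>(\<sigma> t - s) D\<close> up to a relatively small error.
\<close>

lemma has_delta_derivative_matrix_inv:
  fixes X :: "real \<Rightarrow> real^'n^'n"
  assumes t: "t \<in> T" and X: "has_delta_derivative T X D t" and inv: "\<And>s. s \<in> T \<Longrightarrow> invertible (X s)"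
  shows "has_delta_derivative T (\<lambda>s. matrix_inv (X s))
    (- (matrix_inv (X (\<sigma> t)) ** D ** matrix_inv (X t))) t"
proof -
  have cont: "continuous (at t within T) (\<lambda>s. matrix_inv (X s))"
    using has_delta_derivative_continuous[OF t X] inv t unfolding continuous_within
    by (intro tendsto_matrix_inv) (auto simp: eventually_at_filter)
  moreover have "matrix_inv (X (\<sigma> t)) - matrix_inv (X t)
      = \<mu> t *\<^sub>R (- (matrix_inv (X (\<sigma> t)) ** D ** matrix_inv (X t)))"
  proof -
    have "X t - X (\<sigma> t) = - (\<mu> t *\<^sub>R D)"
      using X by (simp add: has_delta_derivative_iff[OF t] algebra_simps)
    then show ?thesis
      using inv t sigma_in
      by (simp add: matrix_inv_diff mmm.scaleR_left mmm.scaleR_right mmm.minus_left mmm.minus_right)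
  qed
  moreover have "((\<lambda>s. matrix_inv (X s)) has_vector_derivative
      - (matrix_inv (X t) ** D ** matrix_inv (X t))) (at t within T)" if "\<sigma> t = t"
  proof -
    have "((\<lambda>s. (X s - X t) /\<^sub>R (s - t)) \<longlongrightarrow> D) (at t within T)"
      using X that by (simp add: has_delta_derivative_iff[OF t] has_vector_derivative_within_iff_quotient)
    then have "((\<lambda>s. - (matrix_inv (X t) ** ((X s - X t) /\<^sub>R (s - t)) ** matrix_inv (X s)))
        \<longlongrightarrow> - (matrix_inv (X t) ** D ** matrix_inv (X t))) (at t within T)"
      using cont unfolding continuous_within
      by (intro tendsto_minus mmm.tendsto tendsto_const)
    moreover have "\<forall>\<^sub>F s in at t within T.
        - (matrix_inv (X t) ** ((X s - X t) /\<^sub>R (s - t)) ** matrix_inv (X s))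
        = (matrix_inv (X s) - matrix_inv (X t)) /\<^sub>R (s - t)"
      unfolding eventually_at_filter
    proof (intro always_eventually allI impI)
      fix s assume "s \<in> T"
      then have "matrix_inv (X s) - matrix_inv (X t) = - (matrix_inv (X t) - matrix_inv (X s))"
        by simp
      also have "\<dots> = - (matrix_inv (X t) ** (X s - X t) ** matrix_inv (X s))"
        using \<open>s \<in> T\<close> inv t by (simp only: matrix_inv_diff)
      finally show "- (matrix_inv (X t) ** ((X s - X t) /\<^sub>R (s - t)) ** matrix_inv (X s))
        = (matrix_inv (X s) - matrix_inv (X t)) /\<^sub>R (s - t)"
        by (simp only: mmm.scaleR_left mmm.scaleR_right scaleR_minus_right)
    qed
    ultimately show ?thesis
      unfolding has_vector_derivative_within_iff_quotient by (rule Lim_transform_eventually)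
  qed
  ultimately show ?thesis
    by (simp add: has_delta_derivative_iff[OF t])
qed

text \<open>
  For \<open>e > 0\<close> let \<open>c\<close> be the infimum of the points of \<open>[a, b]\<close> where \<open>norm (f c - f a) \<le> e (c - a)\<close>
  fails. The inequality holds at \<open>c\<close> itself, by continuity if \<open>c\<close> is left-dense and since \<open>f\<close> does
  not change over a jump otherwise. It then holds at all points of \<open>T\<close> slightly to the right of
  \<open>c\<close>, because the derivative at \<open>c\<close> is zero or because \<open>c\<close> is the only such point.
\<close>

lemma has_delta_derivative_zero_constant:
  assumes f: "\<And>t. t \<in> T \<Longrightarrow> has_delta_derivative T f 0 t" and ab: "a \<in> T" "b \<in> T"
  shows "f a = f b"
proof -
  have le: "norm (f b - f a) \<le> e * (b - a)" if ab: "a \<in> T" "b \<in> T" "a \<le> b" and e: "e > 0" for a b e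
  proof (rule ccontr)
    assume bad_b: "\<not> ?thesis"
    define S where "S = {c \<in> T. a \<le> c \<and> \<not> norm (f c - f a) \<le> e * (c - a)}"
    have S: "S \<noteq> {}" "bdd_below S"
      using bad_b ab by (auto simp: S_def intro: bdd_belowI[of _ a])
    define c where "c = Inf S"
    have good: "norm (f s - f a) \<le> e * (s - a)" if "s \<in> T" "a \<le> s" "s < c" for s
      using that cInf_lower[OF _ S(2), of s] by (force simp: S_def c_def)
    have "c \<in> closure S"
      unfolding c_def by (rule closure_contains_Inf[OF S])
    moreover have "closure S \<subseteq> T"
      by (rule closure_minimal) (auto simp: S_def closed)
    ultimately have cT: "c \<in> T" by blast
    have ac: "a \<le> c"
      unfolding c_def using S(1) by (intro cInf_greatest) (auto simp: S_def)
    have cont: "continuous (at c within T) f"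
      using has_delta_derivative_continuous[OF cT f[OF cT]] .
    have c_good: "norm (f c - f a) \<le> e * (c - a)"
    proof (cases "c = a")
      case False
      with ac have "a < c" by simp
      show ?thesis
      proof (cases "at c within (T \<inter> {a..<c}) = bot")
        case True
        then obtain d where d: "d > 0" "\<And>s. s \<in> T \<Longrightarrow> a \<le> s \<Longrightarrow> s < c \<Longrightarrow> dist s c \<ge> d"
          unfolding trivial_limit_within islimpt_approachable by force
        obtain v where v: "max a (c - d) < v" "v < c"
          using dense[of "max a (c - d)" c] d(1) \<open>a < c\<close> by auto
        define s where "s = left_point v"
        have s: "s \<in> T" "a \<le> s" "s < c"
          using left_point_in left_point_ge[OF ab(1), of v] left_point_le[of v] v
          by (auto simp: s_def)
        have "\<sigma> s = c"
        proof (rule antisym[OF sigma_le[OF cT s(3)]], rule ccontr)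
          assume "\<not> c \<le> \<sigma> s"
          then have "\<sigma> s \<le> c - d"
            using d(2)[OF sigma_in, of s] sigma_ge[of s] s by (auto simp: dist_real_def)
          then show False
            using le_sigma_left_point[of v] v by (simp add: s_def)
        qed
        then have "f c = f s"
          using has_delta_derivative_sigma[OF s(1) f[OF s(1)]] by simp
        then show ?thesis
          using order_trans[OF good[OF s] mult_left_mono[of "s - a" "c - a" e]] s(3) e by simp
      next
        case False
        have "((\<lambda>s. norm (f s - f a)) \<longlongrightarrow> norm (f c - f a)) (at c within (T \<inter> {a..<c}))"
          using cont unfolding continuous_within
          by (intro tendsto_intros) (rule tendsto_within_subset, auto)
        moreover have "((\<lambda>s. e * (s - a)) \<longlongrightarrow> e * (c - a)) (at c within (T \<inter> {a..<c}))"
          by (intro tendsto_intros)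
        ultimately show ?thesis
          using False good
          by (intro tendsto_le[of "at c within (T \<inter> {a..<c})" "\<lambda>s. e * (s - a)" _ "\<lambda>s. norm (f s - f a)"])
             (auto simp: eventually_at_filter)
      qed
    qed simp
    have "\<exists>d>0. \<forall>s\<in>T. c \<le> s \<and> s < c + d \<longrightarrow> norm (f s - f c) \<le> e * (s - c)"
    proof (cases "\<sigma> c = c")
      case True
      obtain d where "d > 0" "\<And>s. s \<in> T \<Longrightarrow> \<bar>s - c\<bar> < d \<Longrightarrow> norm (f s - f c) \<le> e * \<bar>s - c\<bar>"
        using f[OF cT] e True unfolding has_delta_derivative_def
        by (auto simp: norm_minus_commute abs_minus_commute)
      then show ?thesis
        by (intro exI[of _ d]) force
    next
      case False
      then have "\<sigma> c - c > 0" using sigma_ge[of c] by simp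
      moreover have "s = c" if "s \<in> T" "c \<le> s" "s < c + (\<sigma> c - c)" for s
        using sigma_le[of s c] that by fastforce
      ultimately show ?thesis
        by (intro exI[of _ "\<sigma> c - c"]) fastforce
    qed
    then obtain d where d: "d > 0"
      "\<And>s. s \<in> T \<Longrightarrow> c \<le> s \<Longrightarrow> s < c + d \<Longrightarrow> norm (f s - f c) \<le> e * (s - c)" by blast
    obtain s where s: "s \<in> S" "s < c + d"
      using cInf_lessD[OF S(1), of "c + d"] d(1) by (auto simp: c_def)
    have "c \<le> s"
      using cInf_lower[OF s(1) S(2)] by (simp add: c_def)
    then have "norm (f s - f c) \<le> e * (s - c)"
      using d(2) s by (auto simp: S_def)
    then have "norm (f s - f a) \<le> e * (s - c) + e * (c - a)"
      using c_good norm_triangle_ineq[of "f s - f c" "f c - f a"] by simp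
    then show False
      using s(1) by (simp add: S_def algebra_simps)
  qed
  have "f a = f b" if "a \<in> T" "b \<in> T" "a \<le> b" for a b
  proof -
    have "norm (f b - f a) \<le> 0 + e" if "e > 0" for e
    proof -
      have "norm (f b - f a) \<le> e / (b - a + 1) * (b - a)"
        using le[OF \<open>a \<in> T\<close> \<open>b \<in> T\<close> \<open>a \<le> b\<close>, of "e / (b - a + 1)"] that \<open>a \<le> b\<close> by simp
      also have "\<dots> \<le> e"
        using that \<open>a \<le> b\<close> by (simp add: field_simps)
      finally show ?thesis by simp
    qed
    then show ?thesis
      using field_le_epsilon[of "norm (f b - f a)" 0] by simp
  qed
  then show ?thesis
    using ab by (metis linear)
qed

end

section \<open>Delta antiderivatives\<close>

context relatively_dense_time_scale
begin

lemma has_delta_derivative_cong: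
  assumes "\<And>s. s \<in> T \<Longrightarrow> f s = g s"
  shows "has_delta_derivative T f D t \<longleftrightarrow> has_delta_derivative T g D t"
  using assms by (simp add: has_delta_derivative_def sigma_in cong: ball_cong)

text \<open>
  An integral over a reversed interval is zero, so this is the oriented integral from \<open>0\<close> to \<open>t\<close>
  for either sign of \<open>t\<close>.
\<close>

definition primitive :: "(real \<Rightarrow> 'a::banach) \<Rightarrow> real \<Rightarrow> 'a" where
  "primitive h t = integral {0..t} (\<lambda>u. h (left_point u)) - integral {t..0} (\<lambda>u. h (left_point u))"

lemma primitive_diff:
  assumes h: "rd_continuous T h" and "a \<le> b"
  shows "primitive h b - primitive h a = integral {a..b} (\<lambda>u. h (left_point u))"
proof -
  have comb: "integral {a..c} (\<lambda>u. h (left_point u)) + integral {c..b} (\<lambda>u. h (left_point u))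
      = integral {a..b} (\<lambda>u. h (left_point u))" if "a \<le> c" "c \<le> b" for a b c
    using that rd_continuous_integrable[OF h] by (rule Henstock_Kurzweil_Integration.integral_combine)
  have null: "integral {c..d} (\<lambda>u. h (left_point u)) = 0" if "d \<le> c" for c d
    using that by (cases "c = d") auto
  consider "0 \<le> a" | "a \<le> 0" "0 \<le> b" | "b \<le> 0" by linarith
  then show ?thesis
  proof cases
    case 1
    then show ?thesis
      using comb[of 0 a b] \<open>a \<le> b\<close> by (simp add: primitive_def null algebra_simps)
  next
    case 2
    then show ?thesis
      using comb[of a 0 b] by (simp add: primitive_def null algebra_simps)
  next
    case 3
    then show ?thesis
      using comb[of a b 0] \<open>a \<le> b\<close> by (simp add: primitive_def null algebra_simps)
  qed
qed

text \<open>
  Between two points of \<open>T\<close> near a right-dense \<open>t\<close>, \<open>left_point\<close> takes only values near \<open>t\<close>, where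
  \<open>h\<close> is close to \<open>h t\<close>.
\<close>

lemma has_delta_derivative_primitive:
  assumes h: "rd_continuous T h" and t: "t \<in> T"
  shows "has_delta_derivative T (primitive h) (h t) t"
  unfolding has_delta_derivative_iff[OF t]
proof (intro conjI impI)
  note int = rd_continuous_integrable[OF h]
  have "integral {t..\<sigma> t} (\<lambda>u. h (left_point u)) = integral {t..\<sigma> t} (\<lambda>_. h t)"
  proof (rule integral_spike[of "{\<sigma> t}"])
    fix u assume u: "u \<in> {t..\<sigma> t} - {\<sigma> t}"
    have "left_point u = t"
    proof (rule left_point_unique[OF t])
      show "r \<le> t" if "r \<in> T" "r \<le> u" for r
        using sigma_le[of r t] that u by force
    qed (use u in auto)
    then show "h t = h (left_point u)" by simp
  qed simp
  then show "primitive h (\<sigma> t) - primitive h t = \<mu> t *\<^sub>R h t"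
    using primitive_diff[OF h sigma_ge[of t]] sigma_ge[of t] by (simp add: graininess_def)
  have "continuous_on {t - 1..t + 1} (\<lambda>s. primitive h (t - 1) + integral {t - 1..s} (\<lambda>u. h (left_point u)))"
    by (intro continuous_intros indefinite_integral_continuous_1 int)
  then have "continuous_on {t - 1..t + 1} (primitive h)"
    using primitive_diff[OF h, of "t - 1"]
    by (elim continuous_on_eq) (auto simp flip: primitive_diff[OF h])
  then have "isCont (primitive h) t"
    by (rule continuous_on_interior) simp
  then show "continuous (at t within T) (primitive h)"
    by (rule continuous_at_imp_continuous_at_within)
  assume "\<sigma> t = t"
  then have cont: "continuous (at t within T) h"
    using h t by (simp add: rd_continuous_def)
  show "(primitive h has_vector_derivative h t) (at t within T)"
    unfolding has_vector_derivative_def has_derivative_within_alt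
  proof (intro conjI allI impI bounded_linear_scaleR_left)
    fix e :: real assume "e > 0"
    with cont obtain d where d: "d > 0" "\<And>s. s \<in> T \<Longrightarrow> dist s t < d \<Longrightarrow> dist (h s) (h t) < e"
      unfolding continuous_within_eps_delta by blast
    have seg: "norm (integral {a..b} (\<lambda>u. h (left_point u)) - (b - a) *\<^sub>R h t) \<le> e * (b - a)"
      if ab: "a \<in> T" "b \<in> T" "a \<le> b" "\<And>u. a \<le> u \<Longrightarrow> u \<le> b \<Longrightarrow> \<bar>u - t\<bar> < d" for a b
    proof -
      have "integral {a..b} (\<lambda>u. h (left_point u)) - (b - a) *\<^sub>R h t
          = integral {a..b} (\<lambda>u. h (left_point u) - h t)"
        using ab(3) by (subst integral_diff[OF int]) auto
      also have "norm \<dots> \<le> integral {a..b} (\<lambda>_. e)"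
      proof (rule integral_norm_bound_integral)
        fix u assume "u \<in> {a..b}"
        then have "\<bar>left_point u - t\<bar> < d"
          using left_point_ge[OF ab(1), of u] left_point_le[of u] by (intro ab(4)) auto
        then show "norm (h (left_point u) - h t) \<le> e"
          using d(2)[OF left_point_in, of u] by (simp add: dist_norm)
      qed (intro integrable_diff int, auto)
      finally show ?thesis using ab(3) by (simp add: mult.commute)
    qed
    have "norm (primitive h s - primitive h t - (s - t) *\<^sub>R h t) \<le> e * norm (s - t)"
      if s: "s \<in> T" "norm (s - t) < d" for s
    proof (cases "t \<le> s")
      case True
      then show ?thesis
        using seg[OF t s(1)] s(2) by (simp add: primitive_diff[OF h])
    next
      case False
      have "primitive h s - primitive h t - (s - t) *\<^sub>R h t
          = - (primitive h t - primitive h s - (t - s) *\<^sub>R h t)"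
        by (simp add: algebra_simps)
      then show ?thesis
        using seg[OF s(1) t] s(2) False
        by (simp only: norm_minus_cancel) (simp add: primitive_diff[OF h])
    qed
    then show "\<exists>d>0. \<forall>s\<in>T. norm (s - t) < d \<longrightarrow>
        norm (primitive h s - primitive h t - (s - t) *\<^sub>R h t) \<le> e * norm (s - t)"
      using d(1) by blast
  qed
qed

lemma delta_fundamental_theorem:
  fixes f :: "real \<Rightarrow> 'a::banach"
  assumes f: "\<And>t. t \<in> T \<Longrightarrow> has_delta_derivative T f (h t) t" and h: "rd_continuous T h"
    and ab: "a \<in> T" "b \<in> T" "a \<le> b"
  shows "f b - f a = integral {a..b} (\<lambda>u. h (left_point u))"
proof -
  have "has_delta_derivative T (\<lambda>s. f s - primitive h s) 0 t" if "t \<in> T" for t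
    using has_delta_derivative_diff[OF that f has_delta_derivative_primitive[OF h]] that by simp
  then have "f a - primitive h a = f b - primitive h b"
    using has_delta_derivative_zero_constant ab by blast
  then show ?thesis
    using primitive_diff[OF h ab(3)] by (simp add: algebra_simps)
qed

lemma has_delta_derivative_of_integral:
  fixes f :: "real \<Rightarrow> 'a::banach"
  assumes f: "\<And>a b. a \<in> T \<Longrightarrow> b \<in> T \<Longrightarrow> a \<le> b \<Longrightarrow> f b - f a = integral {a..b} (\<lambda>u. h (left_point u))"
    and h: "rd_continuous T h" and t: "t \<in> T"
  shows "has_delta_derivative T f (h t) t"
proof -
  have "f s = primitive h s - (primitive h t - f t)" if "s \<in> T" for s
    using f[OF that t] f[OF t that] primitive_diff[OF h, of s t] primitive_diff[OF h, of t s]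
    by (cases "s \<le> t") (simp_all add: algebra_simps)
  then have "has_delta_derivative T f (h t) t \<longleftrightarrow>
      has_delta_derivative T (\<lambda>s. primitive h s - (primitive h t - f t)) (h t) t"
    by (rule has_delta_derivative_cong)
  then show ?thesis
    using has_delta_derivative_diff[OF t has_delta_derivative_primitive[OF h t]
        has_delta_derivative_const[OF t]] by simp
qed

end

section \<open>Decay of the exponential\<close>

text \<open>
  The slope \<open>g z\<close> is \<open>ln (1 + \<alpha> z) / z\<close>, continued to \<open>z = 0\<close>; with \<open>z = \<mu> t\<close> it is the
  cylinder transform of \<open>\<alpha>\<close>.
\<close>

lemma ln_slope_continuous:
  fixes \<alpha> :: real
  assumes "\<alpha> > 0"
  obtains g :: "real \<Rightarrow> real" where "isCont g 0" "g 0 = \<alpha>" "\<And>z. ln (1 + \<alpha> * z) = g z * z"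
proof -
  have "((\<lambda>z. ln (1 + \<alpha> * z)) has_real_derivative \<alpha>) (at 0)"
    by (auto intro!: derivative_eq_intros)
  then show ?thesis
    unfolding CARAT_DERIV using that by auto
qed

context relatively_dense_time_scale
begin

text \<open>
  The exponential is \<open>exp (L s - L t)\<close>, where the derivative of \<open>L\<close> is the cylinder transform
  \<open>ln (1 + \<mu> \<alpha>) / \<mu>\<close>, to be read as \<open>\<alpha>\<close> where \<open>\<mu> = 0\<close>. Since \<open>ln (1 + x) \<ge> x / (1 + x)\<close> and
  \<open>\<mu> \<le> m\<close>, this derivative is at least \<open>\<alpha> / (1 + \<alpha> m)\<close>. That every solution equals \<open>exp (- L)\<close>
  up to a factor follows since its product with \<open>exp L\<close> has derivative zero.
\<close>

lemma ts_exp_ominus_le: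
  assumes \<alpha>: "\<alpha> > 0" and st: "s \<in> T" "t \<in> T" "s \<le> t"
  shows "ts_exp T (ominus T \<alpha>) t s \<le> exp (- (\<alpha> / (1 + \<alpha> * m) * (t - s)))"
proof -
  obtain g :: "real \<Rightarrow> real" where g: "isCont g 0" "g 0 = \<alpha>" "\<And>z. ln (1 + \<alpha> * z) = g z * z"
    using ln_slope_continuous[OF \<alpha>] by blast
  define \<xi> where "\<xi> t = g (\<mu> t)" for t
  define L where "L = primitive \<xi>"
  have rd: "rd_continuous T \<xi>"
    unfolding \<xi>_def by (rule rd_continuous_graininess_comp) (rule g(1))
  have L: "has_delta_derivative T L (\<xi> t) t" if "t \<in> T" for t
    unfolding L_def by (rule has_delta_derivative_primitive[OF rd that])
  have pos: "1 + \<alpha> * \<mu> t > 0" for t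
    using \<alpha> graininess_bounds(1)[of t] by (simp add: add_pos_nonneg)
  have jump: "exp (L (\<sigma> t)) = exp (L t) * (1 + \<alpha> * \<mu> t)" if "t \<in> T" for t
  proof -
    have "L (\<sigma> t) = L t + ln (1 + \<alpha> * \<mu> t)"
      using has_delta_derivative_sigma[OF that L[OF that]] g(3)[of "\<mu> t"] by (simp add: \<xi>_def mult.commute)
    then show ?thesis using pos[of t] by (simp add: exp_add)
  qed
  have E: "has_delta_derivative T (\<lambda>t. exp (L t)) (\<alpha> * exp (L t)) t" if t: "t \<in> T" for t
    unfolding has_delta_derivative_iff[OF t]
  proof (intro conjI impI)
    show "exp (L (\<sigma> t)) - exp (L t) = \<mu> t *\<^sub>R (\<alpha> * exp (L t))"
      by (simp add: jump[OF t] algebra_simps)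
    show "continuous (at t within T) (\<lambda>t. exp (L t))"
      by (intro continuous_intros has_delta_derivative_continuous[OF t L[OF t]])
    assume "\<sigma> t = t"
    then show "((\<lambda>t. exp (L t)) has_vector_derivative \<alpha> * exp (L t)) (at t within T)"
      using L[OF t] g(2) unfolding has_delta_derivative_iff[OF t]
      by (auto simp: \<xi>_def graininess_def simp flip: has_real_derivative_iff_has_vector_derivative
          intro!: derivative_eq_intros)
  qed
  have e: "has_delta_derivative T (\<lambda>t. exp (- L t)) (ominus T \<alpha> t * exp (- L t)) t" if t: "t \<in> T" for t
    unfolding has_delta_derivative_iff[OF t]
  proof (intro conjI impI)
    have "exp (- L (\<sigma> t)) = exp (- L t) / (1 + \<alpha> * \<mu> t)"
      using jump[OF t] by (simp add: exp_minus divide_inverse)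
    then show "exp (- L (\<sigma> t)) - exp (- L t) = \<mu> t *\<^sub>R (ominus T \<alpha> t * exp (- L t))"
      using pos[of t] by (simp add: ominus_def field_simps)
    show "continuous (at t within T) (\<lambda>t. exp (- L t))"
      by (intro continuous_intros has_delta_derivative_continuous[OF t L[OF t]])
    assume "\<sigma> t = t"
    then show "((\<lambda>t. exp (- L t)) has_vector_derivative ominus T \<alpha> t * exp (- L t)) (at t within T)"
      using L[OF t] g(2) unfolding has_delta_derivative_iff[OF t]
      by (auto simp: \<xi>_def graininess_def ominus_def simp flip: has_real_derivative_iff_has_vector_derivative
          intro!: derivative_eq_intros)
  qed
  have uniq: "y t * exp (L t) = y s * exp (L s)"
    if y: "\<And>u. u \<in> T \<Longrightarrow> has_delta_derivative T y (ominus T \<alpha> u * y u) u" for y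
  proof (rule has_delta_derivative_zero_constant[OF _ st(2) st(1)])
    fix u assume u: "u \<in> T"
    have "y (\<sigma> u) * (\<alpha> * exp (L u)) + ominus T \<alpha> u * y u * exp (L u) = 0"
      using has_delta_derivative_sigma[OF u y[OF u]] pos[of u]
      by (simp add: ominus_def field_simps)
    then show "has_delta_derivative T (\<lambda>t. y t * exp (L t)) 0 u"
      using has_delta_derivative_bilinear[OF bounded_bilinear_mult u y[OF u] E[OF u]] by simp
  qed
  have "ts_exp T (ominus T \<alpha>) t s = exp (L s - L t)"
    unfolding ts_exp_def
  proof (rule the_equality)
    let ?y = "\<lambda>t. exp (L s) * exp (- L t)"
    have "\<forall>u\<in>T. has_delta_derivative T ?y (ominus T \<alpha> u * ?y u) u"
      using has_delta_derivative_linear[OF bounded_linear_mult_right _ e, of _ "exp (L s)"]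
      by (simp add: mult_ac)
    then show "\<exists>y. (\<forall>u\<in>T. has_delta_derivative T y (ominus T \<alpha> u * y u) u) \<and> y s = 1 \<and> y t = exp (L s - L t)"
      by (intro exI[of _ ?y]) (simp add: exp_diff exp_minus divide_inverse)
  next
    fix v assume "\<exists>y. (\<forall>u\<in>T. has_delta_derivative T y (ominus T \<alpha> u * y u) u) \<and> y s = 1 \<and> y t = v"
    then show "v = exp (L s - L t)"
      using uniq by (auto simp: exp_diff field_simps)
  qed
  also have "L s - L t \<le> - (\<alpha> / (1 + \<alpha> * m) * (t - s))"
  proof -
    have "\<alpha> / (1 + \<alpha> * m) \<le> \<xi> r" for r
    proof -
      have "\<alpha> / (1 + \<alpha> * m) \<le> \<alpha> / (1 + \<alpha> * \<mu> r)"
        using \<alpha> pos[of r] graininess_bounds(2)[of r] m_pos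
        by (intro divide_left_mono mult_pos_pos) (auto simp: add_pos_pos)
      also have "\<dots> \<le> \<xi> r"
      proof (cases "\<mu> r = 0")
        case True
        then show ?thesis by (simp add: \<xi>_def g)
      next
        case False
        then have \<mu>: "\<mu> r > 0" using graininess_bounds(1)[of r] by simp
        have "- ln (1 + \<alpha> * \<mu> r) \<le> inverse (1 + \<alpha> * \<mu> r) - 1"
          using ln_le_minus_one[of "inverse (1 + \<alpha> * \<mu> r)"] pos[of r] by (simp add: ln_inverse)
        then have "\<alpha> / (1 + \<alpha> * \<mu> r) * \<mu> r \<le> g (\<mu> r) * \<mu> r"
          using pos[of r] by (simp add: g(3) field_simps)
        then show ?thesis
          using \<mu> unfolding \<xi>_def by (rule mult_right_le_imp_le)
      qed
      finally show ?thesis .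
    qed
    then have "integral {s..t} (\<lambda>_. \<alpha> / (1 + \<alpha> * m)) \<le> integral {s..t} (\<lambda>u. \<xi> (left_point u))"
      by (intro integral_le rd_continuous_integrable[OF rd]) auto
    also have "\<dots> = L t - L s"
      unfolding L_def by (rule primitive_diff[OF rd st(3), symmetric])
    finally show ?thesis using st(3) by (simp add: mult.commute)
  qed
  finally show ?thesis by simp
qed

end

section \<open>Bounded solutions under an exponential dichotomy\<close>

lemma exp_decay_small:
  fixes C e \<beta> :: real
  assumes "\<beta> > 0" "e > 0"
  obtains N where "\<And>v. v \<ge> N \<Longrightarrow> C * exp (- (\<beta> * v)) < e"
proof -
  have "((\<lambda>v. C * exp (- (\<beta> * v))) \<longlongrightarrow> 0) at_top"
    using assms(1) by real_asymp
  then have "\<forall>\<^sub>F v in at_top. C * exp (- (\<beta> * v)) < e"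
    using assms(2) by (rule order_tendstoD)
  then show ?thesis
    using that unfolding eventually_at_top_linorder by blast
qed

lemma Cauchy_filter_convergent:
  fixes V :: "'a \<Rightarrow> 'b::banach"
  assumes "F \<noteq> bot"
    and "\<And>e. e > 0 \<Longrightarrow> \<exists>P. eventually P F \<and> (\<forall>x y. P x \<and> P y \<longrightarrow> dist (V x) (V y) < e)"
  shows "\<exists>p. (V \<longlongrightarrow> p) F"
  using cauchy_filter_complete_converges[of "filtermap V F" UNIV] assms
  by (auto simp: cauchy_filter_metric_filtermap filtermap_bot_iff complete_UNIV filterlim_def)

context relatively_dense_time_scale
begin

abbreviation "T_top \<equiv> inf at_top (principal T)"
abbreviation "T_bot \<equiv> inf at_bot (principal T)"

lemma T_top_nontrivial: "T_top \<noteq> bot" and T_bot_nontrivial: "T_bot \<noteq> bot"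
proof -
  show "T_top \<noteq> bot"
    unfolding trivial_limit_def eventually_inf_principal eventually_at_top_linorder
    using relatively_dense by (meson less_imp_le)
  show "T_bot \<noteq> bot"
    unfolding trivial_limit_def eventually_inf_principal eventually_at_bot_linorder
    using left_point_in left_point_le by blast
qed

lemma eventually_T_bot: "(\<And>a. a \<in> T \<Longrightarrow> a \<le> N \<Longrightarrow> Q a) \<Longrightarrow> eventually Q T_bot"
  and eventually_T_top: "(\<And>a. a \<in> T \<Longrightarrow> N \<le> a \<Longrightarrow> Q a) \<Longrightarrow> eventually Q T_top"
  unfolding eventually_inf_principal eventually_at_bot_linorder eventually_at_top_linorder by blast+

lemma exponentially_Cauchy_convergent:
  fixes V :: "real \<Rightarrow> 'b::banach"
  assumes "\<beta> > 0" "C \<ge> 0"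
  shows "(\<And>a' a. a' \<in> T \<Longrightarrow> a \<in> T \<Longrightarrow> a' \<le> a \<Longrightarrow> a \<le> t \<Longrightarrow> norm (V a - V a') \<le> C * exp (- (\<beta> * (t - a))))
      \<Longrightarrow> \<exists>p. (V \<longlongrightarrow> p) T_bot"
    and "(\<And>b b'. b \<in> T \<Longrightarrow> b' \<in> T \<Longrightarrow> t \<le> b \<Longrightarrow> b \<le> b' \<Longrightarrow> norm (V b' - V b) \<le> C * exp (- (\<beta> * (b - t))))
      \<Longrightarrow> \<exists>p. (V \<longlongrightarrow> p) T_top"
proof -
  assume V: "norm (V a - V a') \<le> C * exp (- (\<beta> * (t - a)))"
    if "a' \<in> T" "a \<in> T" "a' \<le> a" "a \<le> t" for a' a
  show "\<exists>p. (V \<longlongrightarrow> p) T_bot"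
  proof (rule Cauchy_filter_convergent[OF T_bot_nontrivial])
    fix e :: real assume "e > 0"
    then obtain N where N: "\<And>v. v \<ge> N \<Longrightarrow> C * exp (- (\<beta> * v)) < e"
      using exp_decay_small[OF \<open>\<beta> > 0\<close>] by blast
    have "dist (V x) (V y) < e" if "x \<in> T" "y \<in> T" "x \<le> min t (t - N)" "y \<le> min t (t - N)" for x y
      using V[of x y] V[of y x] N[of "t - x"] N[of "t - y"] that
      by (cases "x \<le> y") (auto simp: dist_norm norm_minus_commute)
    then show "\<exists>P. eventually P T_bot \<and> (\<forall>x y. P x \<and> P y \<longrightarrow> dist (V x) (V y) < e)"
      by (intro exI[of _ "\<lambda>x. x \<in> T \<and> x \<le> min t (t - N)"])
         (auto intro: eventually_T_bot[of "min t (t - N)"])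
  qed
next
  assume V: "norm (V b' - V b) \<le> C * exp (- (\<beta> * (b - t)))"
    if "b \<in> T" "b' \<in> T" "t \<le> b" "b \<le> b'" for b b'
  show "\<exists>p. (V \<longlongrightarrow> p) T_top"
  proof (rule Cauchy_filter_convergent[OF T_top_nontrivial])
    fix e :: real assume "e > 0"
    then obtain N where N: "\<And>v. v \<ge> N \<Longrightarrow> C * exp (- (\<beta> * v)) < e"
      using exp_decay_small[OF \<open>\<beta> > 0\<close>] by blast
    have "dist (V x) (V y) < e" if "x \<in> T" "y \<in> T" "max t (t + N) \<le> x" "max t (t + N) \<le> y" for x y
      using V[of x y] V[of y x] N[of "x - t"] N[of "y - t"] that
      by (cases "x \<le> y") (auto simp: dist_norm norm_minus_commute)
    then show "\<exists>P. eventually P T_top \<and> (\<forall>x y. P x \<and> P y \<longrightarrow> dist (V x) (V y) < e)"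
      by (intro exI[of _ "\<lambda>x. x \<in> T \<and> max t (t + N) \<le> x"])
         (auto intro: eventually_T_top[of "max t (t + N)"])
  qed
qed

lemma exponential_dichotomy_exp_bounds:
  assumes "exponential_dichotomy T A X P"
  obtains k \<beta> where "k > 0" "\<beta> > 0"
    "\<And>s t. s \<in> T \<Longrightarrow> t \<in> T \<Longrightarrow> \<sigma> s \<le> t \<Longrightarrow>
      norm (X t ** P ** matrix_inv (X (\<sigma> s))) \<le> k * exp (- (\<beta> * (t - \<sigma> s)))"
    "\<And>s t. s \<in> T \<Longrightarrow> t \<in> T \<Longrightarrow> t \<le> \<sigma> s \<Longrightarrow>
      norm (X t ** (mat 1 - P) ** matrix_inv (X (\<sigma> s))) \<le> k * exp (- (\<beta> * (\<sigma> s - t)))"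
proof -
  obtain k \<alpha> where k: "k > 0" and \<alpha>: "\<alpha> > 0"
    and P: "\<And>s t. s \<in> T \<Longrightarrow> t \<in> T \<Longrightarrow> t \<ge> \<sigma> s \<Longrightarrow>
      norm (X t ** P ** matrix_inv (X (\<sigma> s))) \<le> k * ts_exp T (ominus T \<alpha>) t (\<sigma> s)"
    and Q: "\<And>s t. s \<in> T \<Longrightarrow> t \<in> T \<Longrightarrow> t \<le> \<sigma> s \<Longrightarrow>
      norm (X t ** (mat 1 - P) ** matrix_inv (X (\<sigma> s))) \<le> k * ts_exp T (ominus T \<alpha>) (\<sigma> s) t"
    using assms unfolding exponential_dichotomy_def by blast
  have "\<alpha> / (1 + \<alpha> * m) > 0"
    using \<alpha> m_pos by (simp add: add_pos_pos)
  moreover note order_trans[OF P mult_left_mono[OF ts_exp_ominus_le[OF \<alpha>] less_imp_le[OF k]]]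
    order_trans[OF Q mult_left_mono[OF ts_exp_ominus_le[OF \<alpha>] less_imp_le[OF k]]]
  ultimately show ?thesis
    using that[OF k, of "\<alpha> / (1 + \<alpha> * m)"] sigma_in by blast
qed

end

text \<open>
  An exponential dichotomy with the time scale exponential replaced by the ordinary one, which
  is the form in which its estimates can be integrated over the reals.
\<close>

locale dichotomous_system = relatively_dense_time_scale +
  fixes A X :: "real \<Rightarrow> real^'n^'n" and P :: "real^'n^'n" and k \<beta> :: real
  assumes fundamental: "fundamental_matrix T A X"
    and k_pos: "k > 0" and \<beta>_pos: "\<beta> > 0"
    and stable: "\<And>s t. s \<in> T \<Longrightarrow> t \<in> T \<Longrightarrow> \<sigma> s \<le> t \<Longrightarrow>
      norm (X t ** P ** matrix_inv (X (\<sigma> s))) \<le> k * exp (- (\<beta> * (t - \<sigma> s)))"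
    and unstable: "\<And>s t. s \<in> T \<Longrightarrow> t \<in> T \<Longrightarrow> t \<le> \<sigma> s \<Longrightarrow>
      norm (X t ** (mat 1 - P) ** matrix_inv (X (\<sigma> s))) \<le> k * exp (- (\<beta> * (\<sigma> s - t)))"
begin

lemma X_derivative: "t \<in> T \<Longrightarrow> has_delta_derivative T X (A t ** X t) t"
  and X_invertible: "t \<in> T \<Longrightarrow> invertible (X t)"
  using fundamental by (auto simp: fundamental_matrix_def)

lemma X_inv_derivative:
  assumes "t \<in> T"
  shows "has_delta_derivative T (\<lambda>s. matrix_inv (X s)) (- (matrix_inv (X (\<sigma> t)) ** A t)) t"
  using has_delta_derivative_matrix_inv[OF assms X_derivative[OF assms] X_invertible]
  by (simp add: matrix_inv_cancel X_invertible assms flip: matrix_mul_assoc)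

text \<open>
  A solution \<open>z\<close> is \<open>X t c\<close> for a constant vector \<open>c\<close>. For bounded \<open>z\<close> both components vanish:
  \<open>X t P c = X t P inverse X u z u\<close> decays as \<open>u\<close> tends to minus infinity and
  \<open>X t (1 - P) c = X t (1 - P) inverse X u z u\<close> decays as \<open>u\<close> tends to plus infinity.
\<close>

lemma bounded_homogeneous_solution_zero:
  assumes z: "\<And>t. t \<in> T \<Longrightarrow> has_delta_derivative T z (A t *v z t) t"
    and bd: "\<And>t. t \<in> T \<Longrightarrow> norm (z t) \<le> Z" and t: "t \<in> T"
  shows "z t = 0"
proof -
  define c where "c = matrix_inv (X t) *v z t"
  have "matrix_inv (X s) *v z s = c" if "s \<in> T" for s
    unfolding c_def
  proof (rule has_delta_derivative_zero_constant[OF _ that t])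
    fix u assume u: "u \<in> T"
    show "has_delta_derivative T (\<lambda>s. matrix_inv (X s) *v z s) 0 u"
      using has_delta_derivative_bilinear[OF bounded_bilinear_matrix_vector_mult u
          X_inv_derivative[OF u] z[OF u]]
      by (simp add: matrix_vector_mul_assoc mvm.minus_left)
  qed
  then have zc: "z s = X s *v c" if "s \<in> T" for s
    using that X_invertible[OF that] by (metis matrix_inv_cancel(3))
  have small: "x \<le> 0" if "\<And>N. \<exists>v\<ge>N. x \<le> k * Z * exp (- (\<beta> * v))" for x :: real
  proof (rule ccontr)
    assume "\<not> x \<le> 0"
    then obtain N where "\<And>v. v \<ge> N \<Longrightarrow> k * Z * exp (- (\<beta> * v)) < x"
      using exp_decay_small[OF \<beta>_pos, of x "k * Z"] by auto
    then show False
      using that[of N] by force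
  qed
  have comp: "norm (X t *v (Q *v c)) \<le> k * Z * exp (- (\<beta> * v))"
    if "s \<in> T" "norm (X t ** Q ** matrix_inv (X (\<sigma> s))) \<le> k * exp (- (\<beta> * v))" for Q s v
  proof -
    have "X t *v (Q *v c) = (X t ** Q ** matrix_inv (X (\<sigma> s))) *v z (\<sigma> s)"
      by (simp add: zc[OF sigma_in] matrix_inv_cancel X_invertible sigma_in flip: matrix_vector_mul_assoc)
    also have "norm \<dots> \<le> norm (X t ** Q ** matrix_inv (X (\<sigma> s))) * norm (z (\<sigma> s))"
      by (rule norm_matrix_vector_mult_le)
    also have "\<dots> \<le> (k * exp (- (\<beta> * v))) * Z"
      using that bd[OF sigma_in] k_pos by (intro mult_mono) auto
    finally show ?thesis by (simp add: mult_ac)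
  qed
  have "norm (X t *v (P *v c)) \<le> 0"
  proof (rule small)
    fix N
    define s where "s = left_point (min (t - m) (t - m - N))"
    have "s \<le> min (t - m) (t - m - N)"
      unfolding s_def by (rule left_point_le)
    then have "\<sigma> s \<le> t" "N \<le> t - \<sigma> s"
      using sigma_le_add[of s] by auto
    then show "\<exists>v\<ge>N. norm (X t *v (P *v c)) \<le> k * Z * exp (- (\<beta> * v))"
      using comp[of s P "t - \<sigma> s"] stable[of s t] t left_point_in by (auto simp: s_def)
  qed
  moreover have "norm (X t *v ((mat 1 - P) *v c)) \<le> 0"
  proof (rule small)
    fix N
    obtain s where s: "s \<in> T" "max t (t + N) < s"
      using relatively_dense by blast
    then have "t \<le> \<sigma> s" "N \<le> \<sigma> s - t"
      using sigma_ge[of s] by auto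
    then show "\<exists>v\<ge>N. norm (X t *v ((mat 1 - P) *v c)) \<le> k * Z * exp (- (\<beta> * v))"
      using comp[of s "mat 1 - P" "\<sigma> s - t"] unstable[of s t] t s by auto
  qed
  moreover have "z t = X t *v (P *v c) + X t *v ((mat 1 - P) *v c)"
    using zc[OF t] by (simp add: mvm.diff_left mvm.diff_right)
  ultimately show ?thesis by simp
qed

lemma bounded_solution_unique:
  assumes x: "\<And>t. t \<in> T \<Longrightarrow> has_delta_derivative T x (A t *v x t + f t) t"
    and y: "\<And>t. t \<in> T \<Longrightarrow> has_delta_derivative T y (A t *v y t + f t) t"
    and bd: "\<And>t. t \<in> T \<Longrightarrow> norm (x t) \<le> B" "\<And>t. t \<in> T \<Longrightarrow> norm (y t) \<le> C" and t: "t \<in> T"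
  shows "x t = y t"
proof -
  have "x t - y t = 0"
  proof (rule bounded_homogeneous_solution_zero[OF _ _ t])
    fix s assume s: "s \<in> T"
    show "has_delta_derivative T (\<lambda>s. x s - y s) (A s *v (x s - y s)) s"
      using has_delta_derivative_diff[OF s x[OF s] y[OF s]] by (simp add: mvm.diff_right)
    show "norm (x s - y s) \<le> B + C"
      using norm_triangle_ineq4[of "x s" "y s"] bd[OF s] by simp
  qed
  then show ?thesis by simp
qed

text \<open>
  With a delta antiderivative \<open>W\<close> of \<open>inverse X (\<sigma> s) f s\<close>, the two improper integrals are
  \<open>X t (P W t - p)\<close> and \<open>X t (q - (1 - P) W t)\<close>, where \<open>p\<close> is the limit of \<open>P W\<close> at minus infinity
  and \<open>q\<close> that of \<open>(1 - P) W\<close> at plus infinity. Their difference \<open>X t (W t - (p + q))\<close> is a solution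
  by variation of constants. The dichotomy estimates give the existence of the limits and the
  bound, which is uniform in \<open>t\<close>.
\<close>

lemma bounded_solution_exists:
  assumes f: "rd_continuous T f" and F: "\<And>t. t \<in> T \<Longrightarrow> norm (f t) \<le> F"
  obtains x B where "\<And>t. t \<in> T \<Longrightarrow> has_delta_derivative T x (A t *v x t + f t) t"
    "\<And>t. t \<in> T \<Longrightarrow> norm (x t) \<le> B"
    "\<And>t. t \<in> T \<Longrightarrow> \<exists>I1 I2.
       has_delta_integral_from_bot T (\<lambda>s. (X t ** P ** matrix_inv (X (\<sigma> s))) *v f s) t I1 \<and>
       has_delta_integral_to_top T (\<lambda>s. (X t ** (mat 1 - P) ** matrix_inv (X (\<sigma> s))) *v f s) t I2 \<and>
       x t = I1 - I2"
proof -
  define h where "h s = matrix_inv (X (\<sigma> s)) *v f s" for s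
  have h: "rd_continuous T h"
    unfolding h_def
    by (rule rd_continuous_bilinear[OF bounded_bilinear_matrix_vector_mult
          rd_continuous_comp_sigma[OF has_delta_derivative_continuous[OF _ X_inv_derivative]] f])
  define W where "W = primitive h"
  have W: "has_delta_derivative T W (h t) t" if "t \<in> T" for t
    unfolding W_def by (rule has_delta_derivative_primitive[OF h that])
  have XQ: "X t *v (Q *v h s) = (X t ** Q ** matrix_inv (X (\<sigma> s))) *v f s" for Q t s
    by (simp add: h_def matrix_vector_mul_assoc matrix_mul_assoc)
  have F0: "F \<ge> 0"
    using F[OF sigma_in] norm_ge_zero order_trans by blast
  have XQ_le: "norm (X t *v (Q *v h s)) \<le> k * exp (- (\<beta> * v)) * F"
    if "s \<in> T" "norm (X t ** Q ** matrix_inv (X (\<sigma> s))) \<le> k * exp (- (\<beta> * v))" for Q t s v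
    unfolding XQ using that F[of s] F0 k_pos
    by (intro order_trans[OF norm_matrix_vector_mult_le] mult_mono) auto
  \<comment> \<open>The end points are left out since for \<open>u = b = t\<close> the point \<open>\<sigma> (left_point u)\<close> may lie
    beyond \<open>t\<close>, where the stable estimate says nothing.\<close>
  have XQ_int: "norm (X t *v (Q *v (W b - W a))) \<le> integral {a..b} g"
    if "a \<le> b" "g integrable_on {a..b}"
      "\<And>u. a < u \<Longrightarrow> u < b \<Longrightarrow> norm (X t *v (Q *v h (left_point u))) \<le> g u" for Q t a b g
  proof -
    have lin: "bounded_linear (\<lambda>v. X t *v (Q *v v))"
      by (rule bounded_linear_compose[OF mvm.bounded_linear_right mvm.bounded_linear_right])
    have "X t *v (Q *v (W b - W a)) = integral {a..b} (\<lambda>u. X t *v (Q *v h (left_point u)))"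
      unfolding W_def primitive_diff[OF h that(1)]
      using integral_linear[OF rd_continuous_integrable[OF h] lin, of a b] by (simp add: o_def)
    also have "\<dots> = integral {a<..<b} (\<lambda>u. X t *v (Q *v h (left_point u)))"
      by (rule integral_open_interval_real)
    also have "norm \<dots> \<le> integral {a<..<b} g"
      using that integrable_linear[OF rd_continuous_integrable[OF h] lin, of a b]
      by (intro integral_norm_bound_integral) (auto simp: integrable_on_open_interval_real o_def)
    finally show ?thesis by (simp add: integral_open_interval_real)
  qed
  define C where "C = k * F * exp (\<beta> * m) / \<beta>"
  have C0: "C \<ge> 0"
    using k_pos F0 \<beta>_pos by (simp add: C_def)
  have left: "norm (X t *v (P *v (W a - W a'))) \<le> C * exp (- (\<beta> * (t - a)))"
    if "t \<in> T" "a \<in> T" "a' \<le> a" "a \<le> t" for t a a'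
  proof -
    have g: "((\<lambda>u. C * \<beta> * exp (- (\<beta> * (t - u)))) has_integral
        (C * exp (- (\<beta> * (t - a))) - C * exp (- (\<beta> * (t - a'))))) {a'..a}"
      using that(3) by (intro fundamental_theorem_of_calculus)
        (auto intro!: derivative_eq_intros simp flip: has_real_derivative_iff_has_vector_derivative)
    have "norm (X t *v (P *v h (left_point u))) \<le> C * \<beta> * exp (- (\<beta> * (t - u)))"
      if u: "a' < u" "u < a" for u
    proof -
      have "\<sigma> (left_point u) \<le> a"
        using sigma_le[OF \<open>a \<in> T\<close>, of "left_point u"] left_point_le[of u] u by simp
      then have "norm (X t *v (P *v h (left_point u))) \<le> k * exp (- (\<beta> * (t - \<sigma> (left_point u)))) * F"
        using \<open>t \<in> T\<close> \<open>a \<le> t\<close> by (intro XQ_le stable left_point_in) auto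
      also have "\<dots> \<le> k * exp (- (\<beta> * (t - u - m))) * F"
        using sigma_le_add[of "left_point u"] left_point_le[of u] k_pos F0 \<beta>_pos
        by (intro mult_right_mono mult_left_mono) auto
      also have "\<dots> = C * \<beta> * exp (- (\<beta> * (t - u)))"
        using \<beta>_pos by (simp add: C_def algebra_simps flip: exp_add)
      finally show ?thesis .
    qed
    then have "norm (X t *v (P *v (W a - W a'))) \<le> integral {a'..a} (\<lambda>u. C * \<beta> * exp (- (\<beta> * (t - u))))"
      using that(3) g by (intro XQ_int) auto
    also have "\<dots> \<le> C * exp (- (\<beta> * (t - a)))"
      using integral_unique[OF g] C0 by simp
    finally show ?thesis .
  qed
  have right: "norm (X t *v ((mat 1 - P) *v (W b' - W b))) \<le> C * exp (- (\<beta> * (b - t)))"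
    if "t \<in> T" "b \<in> T" "t \<le> b" "b \<le> b'" for t b b'
  proof -
    have g: "((\<lambda>u. C * \<beta> * exp (- (\<beta> * (u - t)))) has_integral
        (- C * exp (- (\<beta> * (b' - t))) - - C * exp (- (\<beta> * (b - t))))) {b..b'}"
      using that(4) by (intro fundamental_theorem_of_calculus)
        (auto intro!: derivative_eq_intros simp flip: has_real_derivative_iff_has_vector_derivative)
    have "norm (X t *v ((mat 1 - P) *v h (left_point u))) \<le> C * \<beta> * exp (- (\<beta> * (u - t)))"
      if u: "b < u" for u
    proof -
      have "t \<le> \<sigma> (left_point u)"
        using le_sigma_left_point[of u] u \<open>t \<le> b\<close> by simp
      then have "norm (X t *v ((mat 1 - P) *v h (left_point u))) \<le> k * exp (- (\<beta> * (\<sigma> (left_point u) - t))) * F"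
        using \<open>t \<in> T\<close> by (intro XQ_le unstable left_point_in) auto
      also have "\<dots> \<le> k * exp (- (\<beta> * (u - t))) * F"
        using le_sigma_left_point[of u] k_pos F0 \<beta>_pos
        by (intro mult_right_mono mult_left_mono) auto
      also have "\<dots> \<le> k * (exp (\<beta> * m) * exp (- (\<beta> * (u - t)))) * F"
        using k_pos F0 \<beta>_pos m_pos by (intro mult_right_mono mult_left_mono) auto
      also have "\<dots> = C * \<beta> * exp (- (\<beta> * (u - t)))"
        using \<beta>_pos by (simp add: C_def)
      finally show ?thesis .
    qed
    then have "norm (X t *v ((mat 1 - P) *v (W b' - W b))) \<le> integral {b..b'} (\<lambda>u. C * \<beta> * exp (- (\<beta> * (u - t))))"
      using that(4) g by (intro XQ_int) auto
    also have "\<dots> \<le> C * exp (- (\<beta> * (b - t)))"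
      using integral_unique[OF g] C0 by simp
    finally show ?thesis .
  qed
  obtain t0 where t0: "t0 \<in> T" using sigma_in by blast
  have cancel: "((\<lambda>a. Q *v W a) \<longlongrightarrow> matrix_inv (X t0) *v r) G"
    if "((\<lambda>a. X t0 *v (Q *v W a)) \<longlongrightarrow> r) G" for Q r G
    using mvm.tendsto[OF tendsto_const that, of "matrix_inv (X t0)"]
    by (simp add: matrix_inv_cancel X_invertible t0)
  have "\<exists>r. ((\<lambda>a. X t0 *v (P *v W a)) \<longlongrightarrow> r) T_bot"
    using left[OF t0] by (intro exponentially_Cauchy_convergent(1)[OF \<beta>_pos C0, of t0])
      (simp flip: mvm.diff_right)
  then obtain p where p: "((\<lambda>a. P *v W a) \<longlongrightarrow> p) T_bot"
    using cancel by blast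
  have "\<exists>r. ((\<lambda>a. X t0 *v ((mat 1 - P) *v W a)) \<longlongrightarrow> r) T_top"
    using right[OF t0] by (intro exponentially_Cauchy_convergent(2)[OF \<beta>_pos C0, of t0])
      (simp flip: mvm.diff_right)
  then obtain q where q: "((\<lambda>a. (mat 1 - P) *v W a) \<longlongrightarrow> q) T_top"
    using cancel by blast
  have p': "((\<lambda>a. X t *v (P *v (W t - W a))) \<longlongrightarrow> X t *v (P *v W t - p)) T_bot" for t
    unfolding mvm.diff_right[of P] by (intro mvm.tendsto tendsto_const tendsto_diff p)
  have q': "((\<lambda>b. X t *v ((mat 1 - P) *v (W b - W t))) \<longlongrightarrow> X t *v (q - (mat 1 - P) *v W t)) T_top" for t
    unfolding mvm.diff_right[of "mat 1 - P"] by (intro mvm.tendsto tendsto_const tendsto_diff q)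
  define x where "x t = X t *v (W t - (p + q))" for t
  have x_split: "x t = X t *v (P *v W t - p) - X t *v (q - (mat 1 - P) *v W t)" for t
    by (simp add: x_def mvm.diff_left mvm.diff_right mvm.add_right algebra_simps)
  show ?thesis
  proof (rule that)
    fix t assume t: "t \<in> T"
    have "has_delta_derivative T (\<lambda>s. W s - (p + q)) (h t) t"
      using has_delta_derivative_diff[OF t W[OF t] has_delta_derivative_const[OF t]] by simp
    from has_delta_derivative_bilinear[OF bounded_bilinear_matrix_vector_mult t X_derivative[OF t] this]
    show "has_delta_derivative T x (A t *v x t + f t) t"
      by (simp add: x_def[abs_def] h_def matrix_inv_cancel X_invertible sigma_in add.commute
          flip: matrix_vector_mul_assoc)
    have "norm (X t *v (P *v W t - p)) \<le> C"
    proof (rule tendsto_upperbound[OF tendsto_norm[OF p'] _ T_bot_nontrivial])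
      show "\<forall>\<^sub>F a in T_bot. norm (X t *v (P *v (W t - W a))) \<le> C"
        using left[OF t t] by (intro eventually_T_bot[of t]) simp
    qed
    moreover have "norm (X t *v (q - (mat 1 - P) *v W t)) \<le> C"
    proof (rule tendsto_upperbound[OF tendsto_norm[OF q'] _ T_top_nontrivial])
      show "\<forall>\<^sub>F b in T_top. norm (X t *v ((mat 1 - P) *v (W b - W t))) \<le> C"
        using right[OF t t] by (intro eventually_T_top[of t]) simp
    qed
    ultimately show "norm (x t) \<le> 2 * C"
      unfolding x_split by (intro order_trans[OF norm_triangle_ineq4]) simp
    have int: "has_delta_integral T (\<lambda>s. (X t ** Q ** matrix_inv (X (\<sigma> s))) *v f s) a b
        (X t *v (Q *v (W b - W a)))" for Q a b
      unfolding has_delta_integral_def XQ[symmetric]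
      using has_delta_derivative_linear[OF mvm.bounded_linear_right _
          has_delta_derivative_linear[OF mvm.bounded_linear_right _ W]]
      by (intro exI[of _ "\<lambda>s. X t *v (Q *v W s)"]) (auto simp: mvm.diff_right)
    have "has_delta_integral_from_bot T (\<lambda>s. (X t ** P ** matrix_inv (X (\<sigma> s))) *v f s) t
        (X t *v (P *v W t - p))"
      unfolding has_delta_integral_from_bot_def using int[of P _ t] p'[of t] not_bdd(2) by (intro conjI exI ballI impI)
    moreover have "has_delta_integral_to_top T (\<lambda>s. (X t ** (mat 1 - P) ** matrix_inv (X (\<sigma> s))) *v f s) t
        (X t *v (q - (mat 1 - P) *v W t))"
      unfolding has_delta_integral_to_top_def using int[of "mat 1 - P" t] q'[of t] not_bdd(1) by (intro conjI exI ballI impI)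
    ultimately show "\<exists>I1 I2.
       has_delta_integral_from_bot T (\<lambda>s. (X t ** P ** matrix_inv (X (\<sigma> s))) *v f s) t I1 \<and>
       has_delta_integral_to_top T (\<lambda>s. (X t ** (mat 1 - P) ** matrix_inv (X (\<sigma> s))) *v f s) t I2 \<and>
       x t = I1 - I2"
      using x_split by blast
  qed
qed

end

section \<open>Almost automorphic functions\<close>

definition automorphic_along ::
    "real set \<Rightarrow> (real \<Rightarrow> 'a::banach) \<Rightarrow> (nat \<Rightarrow> real) \<Rightarrow> (real \<Rightarrow> 'a) \<Rightarrow> bool" where
  "automorphic_along T h s hbar \<longleftrightarrow>
     (\<forall>t\<in>ts_core T. (\<lambda>n. h (t + s n)) \<longlonglongrightarrow> hbar t) \<and>
     (\<forall>t\<in>ts_core T. (\<lambda>n. hbar (t - s n)) \<longlonglongrightarrow> h t)"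

lemma almost_automorphic_iff:
  "almost_automorphic T h \<longleftrightarrow> bounded (h ` T) \<and> rd_continuous T h \<and>
    (\<forall>s :: nat \<Rightarrow> real. (\<forall>n. s n \<in> ts_Pi T) \<longrightarrow> (\<exists>r hbar. strict_mono r \<and> automorphic_along T h (s \<circ> r) hbar))"
  by (simp add: almost_automorphic_def automorphic_along_def)

lemma almost_automorphic_bounded:
  assumes "almost_automorphic T h"
  obtains M where "\<And>t. t \<in> T \<Longrightarrow> norm (h t) \<le> M"
proof -
  have "bounded (h ` T)"
    using assms by (simp add: almost_automorphic_def)
  then show ?thesis
    using that by (auto simp: bounded_iff)
qed

lemma automorphic_along_subseq:
  assumes "automorphic_along T h s hbar" "strict_mono r"
  shows "automorphic_along T h (s \<circ> r) hbar"
  unfolding automorphic_along_def o_def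
proof (intro conjI ballI)
  fix t assume t: "t \<in> ts_core T"
  show "(\<lambda>n. h (t + s (r n))) \<longlonglongrightarrow> hbar t"
    using LIMSEQ_subseq_LIMSEQ[of "\<lambda>n. h (t + s n)", OF _ assms(2)] assms(1) t
    by (simp add: automorphic_along_def o_def)
  show "(\<lambda>n. hbar (t - s (r n))) \<longlonglongrightarrow> h t"
    using LIMSEQ_subseq_LIMSEQ[of "\<lambda>n. hbar (t - s n)", OF _ assms(2)] assms(1) t
    by (simp add: automorphic_along_def o_def)
qed

text \<open>
  The components are handled one after the other, each time passing to a further subsequence,
  which keeps the limits already obtained.
\<close>

lemma almost_automorphic_vecI:
  fixes f :: "real \<Rightarrow> ('a::banach)^'n"
  assumes "\<And>i. almost_automorphic T (\<lambda>t. f t $ i)"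
  shows "almost_automorphic T f"
  unfolding almost_automorphic_iff
proof (intro conjI allI impI)
  have "\<forall>i. \<exists>B. \<forall>t\<in>T. norm (f t $ i) \<le> B"
    using assms unfolding almost_automorphic_def bounded_iff by blast
  then obtain B where B: "\<And>i t. t \<in> T \<Longrightarrow> norm (f t $ i) \<le> B i"
    by metis
  have "norm (f t) \<le> (\<Sum>i\<in>UNIV. B i)" if "t \<in> T" for t
    using L2_set_le_sum[of UNIV "\<lambda>i. norm (f t $ i)"] sum_mono[of UNIV "\<lambda>i. norm (f t $ i)" B] B[OF that]
    by (simp add: norm_vec_def)
  then show "bounded (f ` T)"
    unfolding bounded_iff by blast
  show "rd_continuous T f"
    using assms by (simp add: rd_continuous_vec_iff almost_automorphic_def)
  fix s :: "nat \<Rightarrow> real" assume s: "\<forall>n. s n \<in> ts_Pi T"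
  have "\<exists>r. strict_mono r \<and> (\<forall>i\<in>I. \<exists>hbar. automorphic_along T (\<lambda>t. f t $ i) (s \<circ> r) hbar)"
    if "finite I" for I
    using that
  proof induction
    case empty
    show ?case using strict_mono_id by blast
  next
    case (insert i I)
    then obtain r where r: "strict_mono r"
      and I: "\<And>j. j \<in> I \<Longrightarrow> \<exists>hbar. automorphic_along T (\<lambda>t. f t $ j) (s \<circ> r) hbar" by blast
    obtain r' hbar where r': "strict_mono r'" "automorphic_along T (\<lambda>t. f t $ i) (s \<circ> r \<circ> r') hbar"
      using assms[of i] s unfolding almost_automorphic_iff by (metis comp_apply)
    have "\<exists>hbar. automorphic_along T (\<lambda>t. f t $ j) (s \<circ> r \<circ> r') hbar" if "j \<in> insert i I" for j
      using that r' I automorphic_along_subseq by blast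
    then show ?case
      using strict_mono_o[OF r r'(1)] by (metis comp_assoc)
  qed
  from this[of UNIV] obtain r where r: "strict_mono r"
    and "\<forall>i. \<exists>hbar. automorphic_along T (\<lambda>t. f t $ i) (s \<circ> r) hbar" by auto
  then obtain hbar where "\<And>i. automorphic_along T (\<lambda>t. f t $ i) (s \<circ> r) (hbar i)" by metis
  then have "automorphic_along T f (s \<circ> r) (\<lambda>t. \<chi> i. hbar i t)"
    unfolding automorphic_along_def by (auto intro!: vec_tendstoI)
  then show "\<exists>r hbar. strict_mono r \<and> automorphic_along T f (s \<circ> r) hbar"
    using r by blast
qed

lemma almost_automorphic_vec_nth:
  fixes f :: "real \<Rightarrow> ('a::banach)^'n"
  assumes "almost_automorphic T f"
  shows "almost_automorphic T (\<lambda>t. f t $ i)"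
  unfolding almost_automorphic_iff
proof (intro conjI allI impI)
  show "bounded ((\<lambda>t. f t $ i) ` T)"
    using assms bounded_linear_image[OF _ bounded_linear_vec_nth, of "f ` T" i]
    by (simp add: almost_automorphic_def image_image)
  show "rd_continuous T (\<lambda>t. f t $ i)"
    using assms by (simp add: rd_continuous_vec_iff[of T f] almost_automorphic_def)
  fix s :: "nat \<Rightarrow> real" assume "\<forall>n. s n \<in> ts_Pi T"
  then obtain r hbar where "strict_mono r" "automorphic_along T f (s \<circ> r) hbar"
    using assms unfolding almost_automorphic_iff by blast
  then show "\<exists>r hbar. strict_mono r \<and> automorphic_along T (\<lambda>t. f t $ i) (s \<circ> r) hbar"
    unfolding automorphic_along_def
    by (intro exI[of _ r] exI[of _ "\<lambda>t. hbar t $ i"]) (auto intro: tendsto_vec_nth)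
qed

lemma mat_almost_automorphic_iff: "mat_almost_automorphic T A \<longleftrightarrow> almost_automorphic T A"
  unfolding mat_almost_automorphic_def
  by (blast intro: almost_automorphic_vecI dest: almost_automorphic_vec_nth)

text \<open>
  For \<open>t0\<close> in the core, \<open>t0 + \<tau> \<in> T\<close> for every difference \<open>\<tau>\<close> of points of \<open>T\<close>. This makes
  \<open>T - t0\<close> closed under negation and addition, hence a group, and \<open>T\<close> one of its cosets.
\<close>

lemma ts_core_shift:
  assumes core: "ts_core T \<noteq> {}" and \<tau>: "\<tau> \<in> ts_Pi T" and t: "t \<in> T"
  shows "t + \<tau> \<in> T" "t - \<tau> \<in> T"
proof -
  obtain t0 where t0: "t0 \<in> ts_core T" using core by blast
  have Pi: "\<upsilon> \<in> ts_Pi T \<longleftrightarrow> (\<exists>a\<in>T. a + \<upsilon> \<in> T)" for \<upsilon>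
    by (force simp: ts_Pi_def ts_shift_def)
  have add: "t0 + \<upsilon> \<in> T" if "\<upsilon> \<in> ts_Pi T" for \<upsilon>
  proof -
    have "t0 \<in> ts_shift T \<upsilon>" using t0 that by (simp add: ts_core_def)
    then obtain b where "b \<in> T" "t0 = b - \<upsilon>" by (auto simp: ts_shift_def)
    then show ?thesis by simp
  qed
  have "0 \<in> ts_Pi T" using t by (auto simp: Pi)
  then have "t0 \<in> T" using add by force
  have minus: "t0 - \<alpha> \<in> T" if "t0 + \<alpha> \<in> T" for \<alpha>
  proof -
    have "- \<alpha> \<in> ts_Pi T"
      unfolding Pi using \<open>t0 \<in> T\<close> that by (intro bexI[of _ "t0 + \<alpha>"]) auto
    then show ?thesis using add by force
  qed
  have plus: "t0 + (\<alpha> + \<gamma>) \<in> T" if "t0 + \<alpha> \<in> T" "t0 + \<gamma> \<in> T" for \<alpha> \<gamma>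
  proof (rule add)
    show "\<alpha> + \<gamma> \<in> ts_Pi T"
      unfolding Pi using minus that by (intro bexI[of _ "t0 - \<alpha>"]) auto
  qed
  obtain a where a: "a \<in> T" "a + \<tau> \<in> T"
    using \<tau> by (auto simp: Pi)
  have diff: "t0 + ((t - t0) + ((b - t0) + (t0 - c))) \<in> T" if "b \<in> T" "c \<in> T" for b c
  proof (intro plus)
    show "t0 + (t0 - c) \<in> T"
      using minus[of "c - t0"] that by (simp add: algebra_simps)
  qed (use t that in auto)
  show "t + \<tau> \<in> T" "t - \<tau> \<in> T"
    using diff[OF a(2) a(1)] diff[OF a] by (simp_all add: algebra_simps)
qed

lemma ts_core_eq:
  assumes "ts_core T \<noteq> {}" "T \<noteq> {}"
  shows "ts_core T = T"
proof
  have "0 \<in> ts_Pi T"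
    using \<open>T \<noteq> {}\<close> by (auto simp: ts_Pi_def ts_shift_def)
  then show "ts_core T \<subseteq> T"
    by (auto simp: ts_core_def ts_shift_def)
  show "T \<subseteq> ts_core T"
    using ts_core_shift(1)[OF assms(1)]
    by (force simp: ts_core_def ts_shift_def)
qed

text \<open>
  A left limit of \<open>A\<close> need not be a value of \<open>A\<close>; its invertibility comes from the bound \<open>K\<close>.
\<close>

lemma rd_continuous_matrix_inv:
  fixes A :: "real \<Rightarrow> real^'n^'n"
  assumes A: "rd_continuous T A" and inv: "\<And>t. t \<in> T \<Longrightarrow> invertible (A t)"
    and K: "\<And>t. t \<in> T \<Longrightarrow> norm (matrix_inv (A t)) \<le> K"
  shows "rd_continuous T (\<lambda>t. matrix_inv (A t))"
  unfolding rd_continuous_def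
proof (intro conjI ballI impI)
  fix t assume "t \<in> T" "fwd_jump T t = t"
  then show "continuous (at t within T) (\<lambda>t. matrix_inv (A t))"
    using A inv unfolding rd_continuous_def continuous_within
    by (intro tendsto_matrix_inv) (auto simp: eventually_at_filter)
next
  fix t assume "t \<in> T" "bwd_jump T t = t"
  then obtain l where l: "(A \<longlongrightarrow> l) (at t within T \<inter> {..<t})"
    using A unfolding rd_continuous_def by blast
  have bd: "\<forall>\<^sub>F s in at t within T \<inter> {..<t}. invertible (A s) \<and> norm (matrix_inv (A s)) \<le> K"
    using inv K by (auto simp: eventually_at_filter)
  show "\<exists>l. ((\<lambda>t. matrix_inv (A t)) \<longlongrightarrow> l) (at t within T \<inter> {..<t})"
  proof (cases "at t within T \<inter> {..<t} = bot")
    case False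
    show ?thesis
      using tendsto_matrix_inv_bounded[OF l invertible_limit[OF l False bd] bd] by blast
  qed simp
qed

text \<open>
  The bound on the inverses makes the limit of the translates invertible; the way back
  uses continuity of inversion at the invertible matrix \<open>A t\<close>.
\<close>

lemma almost_automorphic_matrix_inv:
  fixes A :: "real \<Rightarrow> real^'n^'n"
  assumes A: "almost_automorphic T A" and inv: "\<And>t. t \<in> T \<Longrightarrow> invertible (A t)"
    and bd: "bounded ((\<lambda>t. matrix_inv (A t)) ` T)" and "T \<noteq> {}"
  shows "almost_automorphic T (\<lambda>t. matrix_inv (A t))"
  unfolding almost_automorphic_iff
proof (intro conjI allI impI)
  obtain K where K: "\<And>t. t \<in> T \<Longrightarrow> norm (matrix_inv (A t)) \<le> K"
    using bd unfolding bounded_iff by blast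
  show "rd_continuous T (\<lambda>t. matrix_inv (A t))"
    using A inv K by (intro rd_continuous_matrix_inv) (auto simp: almost_automorphic_def)
  fix s :: "nat \<Rightarrow> real" assume s: "\<forall>n. s n \<in> ts_Pi T"
  then obtain r Abar where r: "strict_mono r" and Abar: "automorphic_along T A (s \<circ> r) Abar"
    using A unfolding almost_automorphic_iff by blast
  have lim: "invertible (Abar t) \<and> (\<lambda>n. matrix_inv (A (t + s (r n)))) \<longlonglongrightarrow> matrix_inv (Abar t)"
    if t: "t \<in> ts_core T" for t
  proof -
    have T: "t + s (r n) \<in> T" for n
      using ts_core_shift(1)[of T "s (r n)" t] ts_core_eq[of T] t s \<open>T \<noteq> {}\<close> by blast
    have l: "(\<lambda>n. A (t + s (r n))) \<longlonglongrightarrow> Abar t"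
      using Abar t by (simp add: automorphic_along_def)
    have ev: "\<forall>\<^sub>F n in sequentially. invertible (A (t + s (r n))) \<and> norm (matrix_inv (A (t + s (r n)))) \<le> K"
      using inv[OF T] K[OF T] by simp
    show ?thesis
      using tendsto_matrix_inv_bounded[OF l invertible_limit[OF l _ ev] ev] invertible_limit[OF l _ ev] by simp
  qed
  have "(\<lambda>n. matrix_inv (Abar (t - s (r n)))) \<longlonglongrightarrow> matrix_inv (A t)" if t: "t \<in> ts_core T" for t
  proof (rule tendsto_matrix_inv)
    show "(\<lambda>n. Abar (t - s (r n))) \<longlonglongrightarrow> A t"
      using Abar t by (simp add: automorphic_along_def)
    have "t \<in> T" and "t - s (r n) \<in> ts_core T" for n
      using ts_core_shift(2)[of T "s (r n)" t] ts_core_eq[of T] t s \<open>T \<noteq> {}\<close> by blast+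
    then show "invertible (A t)" "\<forall>\<^sub>F n in sequentially. invertible (Abar (t - s (r n)))"
      using inv lim by simp_all
  qed
  then show "\<exists>r hbar. strict_mono r \<and> automorphic_along T (\<lambda>t. matrix_inv (A t)) (s \<circ> r) hbar"
    using r lim unfolding automorphic_along_def
    by (intro exI[of _ r] exI[of _ "\<lambda>t. matrix_inv (Abar t)"]) simp
qed (rule bd)

text \<open>
  A translation number \<open>\<tau>\<close> in \<open>[u - t0 + 1, u - t0 + 1 + l]\<close> moves a point of \<open>T\<close> at distance less
  than 1 from \<open>t0\<close> to a point of \<open>T\<close> between \<open>u\<close> and \<open>u + l + 2\<close>.
\<close>

lemma almost_periodic_relatively_dense:
  assumes "almost_periodic_time_scale T"
  shows "\<exists>m. relatively_dense_time_scale T m"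
proof -
  have T: "closed T" "T \<noteq> {}"
    using assms by (auto simp: almost_periodic_time_scale_def time_scale_def)
  then obtain t0 where t0: "t0 \<in> T" by blast
  obtain l where l: "\<And>a. \<exists>\<tau>\<in>{a..a + l}. ts_shift T \<tau> \<noteq> {} \<and> ts_dist T (ts_shift T \<tau>) < ereal 1"
    using assms unfolding almost_periodic_time_scale_def by (meson zero_less_one)
  have "\<exists>s\<in>T. u < s \<and> s \<le> u + (l + 2)" for u
  proof -
    obtain \<tau> where "\<tau> \<in> {u - t0 + 1..u - t0 + 1 + l}"
      and \<tau>: "ts_shift T \<tau> \<noteq> {}" "ts_dist T (ts_shift T \<tau>) < ereal 1"
      using l[of "u - t0 + 1"] by (elim bexE conjE)
    then have \<tau>_bounds: "u - t0 + 1 \<le> \<tau>" "\<tau> \<le> u - t0 + 1 + l" by simp_all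
    have "ereal (infdist t0 (ts_shift T \<tau>)) \<le> (SUP t\<in>T. ereal (infdist t (ts_shift T \<tau>)))"
      using t0 by (rule SUP_upper)
    also have "\<dots> \<le> ts_dist T (ts_shift T \<tau>)"
      by (simp add: ts_dist_def)
    finally have "infdist t0 (ts_shift T \<tau>) < 1"
      using \<tau>(2) by (metis ereal_less_eq(3) less_ereal.simps(1) order.strict_trans1)
    then obtain a where "a \<in> ts_shift T \<tau>" "dist t0 a < 1"
      using infdist_notempty[OF \<tau>(1), of t0] cInf_lessD[of "dist t0 ` ts_shift T \<tau>" 1] \<tau>(1)
      by auto
    then show ?thesis
      using \<tau>_bounds by (intro bexI[of _ "a + \<tau>"]) (auto simp: ts_shift_def dist_real_def)
  qed
  then show ?thesis
    using T(1) by (intro exI[of _ "l + 2"]) unfold_locales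
qed

section \<open>Limits of translated solutions\<close>

text \<open>
  Convergence on a countable dense set extends to all of \<open>S\<close> by the common Lipschitz constant.
\<close>

lemma equi_Lipschitz_subsequence:
  fixes g :: "nat \<Rightarrow> real \<Rightarrow> 'b::euclidean_space"
  assumes B: "\<And>n t. t \<in> S \<Longrightarrow> norm (g n t) \<le> B"
    and M: "\<And>n s t. s \<in> S \<Longrightarrow> t \<in> S \<Longrightarrow> norm (g n s - g n t) \<le> M * \<bar>s - t\<bar>"
  obtains r gbar where "strict_mono r" "\<And>t. t \<in> S \<Longrightarrow> (\<lambda>n. g (r n) t) \<longlonglongrightarrow> gbar t"
proof -
  obtain C where C: "countable C" "C \<subseteq> S" "S \<subseteq> closure C"
    by (rule separable)
  obtain r where r: "strict_mono r" "\<And>t. t \<in> C \<Longrightarrow> \<exists>l. (\<lambda>n. g (r n) t) \<longlonglongrightarrow> l"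
    using function_convergent_subsequence[OF C(1), of g B] B C(2) by blast
  have "\<exists>l. (\<lambda>n. g (r n) t) \<longlonglongrightarrow> l" if t: "t \<in> S" for t
  proof -
    have "Cauchy (\<lambda>n. g (r n) t)"
      unfolding Cauchy_def
    proof (intro allI impI)
      fix e :: real assume e: "e > 0"
      define L where "L = \<bar>M\<bar> + 1"
      have L: "L > 0" "M \<le> L" by (auto simp: L_def)
      with e have "e / (3 * L) > 0" by simp
      then obtain c where c: "c \<in> C" "dist c t < e / (3 * L)"
        using C(3) t unfolding closure_approachable subset_eq by blast
      have near: "dist (g n c) (g n t) \<le> e / 3" for n
      proof -
        have "dist (g n c) (g n t) \<le> M * \<bar>c - t\<bar>"
          using M[of c t n] c(1) C(2) t by (auto simp: dist_norm)
        also have "\<dots> \<le> L * (e / (3 * L))"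
          using c(2) e L by (intro mult_mono) (auto simp: dist_real_def)
        finally show ?thesis using L by simp
      qed
      have "Cauchy (\<lambda>n. g (r n) c)"
        using r(2)[OF c(1)] LIMSEQ_imp_Cauchy by blast
      then obtain N where N: "\<And>i j. i \<ge> N \<Longrightarrow> j \<ge> N \<Longrightarrow> dist (g (r i) c) (g (r j) c) < e / 3"
        using e unfolding Cauchy_def by (metis divide_pos_pos zero_less_numeral)
      have "dist (g (r i) t) (g (r j) t) < e" if "i \<ge> N" "j \<ge> N" for i j
      proof -
        have "dist (g (r i) t) (g (r j) t)
            \<le> dist (g (r i) t) (g (r i) c) + (dist (g (r i) c) (g (r j) c) + dist (g (r j) c) (g (r j) t))"
          using dist_triangle[of "g (r i) t" "g (r j) t" "g (r i) c"]
            dist_triangle[of "g (r i) c" "g (r j) t" "g (r j) c"] by linarith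
        then show ?thesis
          using near[of "r i"] near[of "r j"] N[OF that] by (simp add: dist_commute)
      qed
      then show "\<exists>N. \<forall>i\<ge>N. \<forall>j\<ge>N. dist (g (r i) t) (g (r j) t) < e" by blast
    qed
    then show ?thesis
      by (simp add: Cauchy_convergent_iff convergent_def)
  qed
  then show ?thesis
    using r(1) that by metis
qed

context relatively_dense_time_scale
begin

lemma graininess_translate:
  assumes \<tau>: "\<And>t. t \<in> T \<Longrightarrow> t + \<tau> \<in> T" "\<And>t. t \<in> T \<Longrightarrow> t - \<tau> \<in> T"
  shows "\<mu> (t + \<tau>) = \<mu> t"
proof -
  have le: "\<sigma> (t + \<upsilon>) \<le> \<sigma> t + \<upsilon>" if "\<And>t. t \<in> T \<Longrightarrow> t + \<upsilon> \<in> T" for \<upsilon> t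
  proof -
    have "\<sigma> (t + \<upsilon>) - \<upsilon> \<le> Inf {s \<in> T. t < s}"
    proof (rule cInf_greatest)
      show "{s \<in> T. t < s} \<noteq> {}" using relatively_dense[of t] by auto
      show "\<sigma> (t + \<upsilon>) - \<upsilon> \<le> s" if "s \<in> {s \<in> T. t < s}" for s
        using sigma_le[of "s + \<upsilon>" "t + \<upsilon>"] that \<open>\<And>t. t \<in> T \<Longrightarrow> t + \<upsilon> \<in> T\<close> by force
    qed
    then show ?thesis by (simp add: sigma_eq)
  qed
  show ?thesis
    using le[of \<tau> t] le[of "- \<tau>" "t + \<tau>"] \<tau> by (simp add: graininess_def)
qed

lemma left_point_translate:
  assumes \<tau>: "\<And>t. t \<in> T \<Longrightarrow> t + \<tau> \<in> T" "\<And>t. t \<in> T \<Longrightarrow> t - \<tau> \<in> T"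
  shows "left_point (u + \<tau>) = left_point u + \<tau>"
proof (rule left_point_unique)
  show "r \<le> left_point u + \<tau>" if "r \<in> T" "r \<le> u + \<tau>" for r
    using left_point_ge[of "r - \<tau>" u] \<tau>(2)[OF that(1)] that(2) by simp
qed (use \<tau>(1) left_point_in left_point_le in auto)

text \<open>
  For rd-continuous \<open>g\<close> the following says that \<open>g\<close> is the delta derivative of \<open>x\<close>. In contrast
  to the derivative it survives pointwise bounded limits of \<open>g\<close>, which need not be rd-continuous.
\<close>

definition has_increments :: "(real \<Rightarrow> 'a::euclidean_space) \<Rightarrow> (real \<Rightarrow> 'a) \<Rightarrow> bool" where
  "has_increments x g \<longleftrightarrow>
    (\<forall>a\<in>T. \<forall>b\<in>T. a \<le> b \<longrightarrow> ((\<lambda>u. g (left_point u)) has_integral (x b - x a)) {a..b})"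

lemma has_increments_of_derivative:
  assumes "\<And>t. t \<in> T \<Longrightarrow> has_delta_derivative T x (g t) t" "rd_continuous T g"
  shows "has_increments x g"
  unfolding has_increments_def
  using delta_fundamental_theorem[OF assms] integrable_integral[OF rd_continuous_integrable[OF assms(2)]]
  by simp

lemma has_increments_derivative:
  assumes "has_increments x g" "rd_continuous T g" "t \<in> T"
  shows "has_delta_derivative T x (g t) t"
proof (rule has_delta_derivative_of_integral[OF _ assms(2,3)])
  show "x b - x a = integral {a..b} (\<lambda>u. g (left_point u))" if "a \<in> T" "b \<in> T" "a \<le> b" for a b
    using assms(1) that by (intro integral_unique[symmetric]) (simp add: has_increments_def)
qed

lemma has_increments_Lipschitz:
  assumes x: "has_increments x g" and K: "\<And>t. t \<in> T \<Longrightarrow> norm (g t) \<le> K"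
    and st: "s \<in> T" "t \<in> T"
  shows "norm (x s - x t) \<le> K * \<bar>s - t\<bar>"
proof -
  have K0: "0 \<le> K" using K[OF st(1)] norm_ge_zero order_trans by blast
  have le: "norm (x b - x a) \<le> K * (b - a)" if "a \<in> T" "b \<in> T" "a \<le> b" for a b
    using has_integral_bound_real[of K "{}" "\<lambda>u. g (left_point u)" "x b - x a" a b] K0 x that
      K[OF left_point_in]
    by (simp add: has_increments_def)
  then show ?thesis
    using le[OF st] le[OF st(2,1)] norm_minus_commute[of "x s" "x t"] by (cases "s \<le> t") auto
qed

lemma has_increments_translate:
  assumes x: "has_increments x g"
    and \<tau>: "\<And>t. t \<in> T \<Longrightarrow> t + \<tau> \<in> T" "\<And>t. t \<in> T \<Longrightarrow> t - \<tau> \<in> T"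
  shows "has_increments (\<lambda>t. x (t + \<tau>)) (\<lambda>t. g (t + \<tau>))"
  unfolding has_increments_def
proof (intro ballI impI)
  fix a b assume "a \<in> T" "b \<in> T" "a \<le> b"
  then have "((\<lambda>u. g (left_point u)) has_integral x (b + \<tau>) - x (a + \<tau>)) {a + \<tau>..b + \<tau>}"
    using x \<tau>(1) by (simp add: has_increments_def)
  then have "((\<lambda>u. g (left_point u)) \<circ> (+) \<tau> has_integral x (b + \<tau>) - x (a + \<tau>)) {a..b}"
    by (simp only: has_integral_shift_Icc_real)
  moreover have "(\<lambda>u. g (left_point u)) \<circ> (+) \<tau> = (\<lambda>u. g (left_point u + \<tau>))"
    by (simp add: o_def left_point_translate[OF \<tau>] add.commute)
  ultimately show "((\<lambda>u. g (left_point u + \<tau>)) has_integral x (b + \<tau>) - x (a + \<tau>)) {a..b}"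
    by simp
qed

lemma has_increments_limit:
  assumes x: "\<And>n. has_increments (x n) (g n)" and K: "\<And>n t. t \<in> T \<Longrightarrow> norm (g n t) \<le> K"
    and lim: "\<And>t. t \<in> T \<Longrightarrow> (\<lambda>n. x n t) \<longlonglongrightarrow> y t" "\<And>t. t \<in> T \<Longrightarrow> (\<lambda>n. g n t) \<longlonglongrightarrow> h t"
  shows "has_increments y h"
  unfolding has_increments_def
proof (intro ballI impI)
  fix a b assume ab: "a \<in> T" "b \<in> T" "a \<le> b"
  show "((\<lambda>u. h (left_point u)) has_integral (y b - y a)) {a..b}"
  proof (rule has_integral_dominated_convergence[where h = "\<lambda>_. K"])
    show "((\<lambda>u. g n (left_point u)) has_integral (x n b - x n a)) {a..b}" for n
      using x ab by (simp add: has_increments_def)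
    show "(\<lambda>n. x n b - x n a) \<longlonglongrightarrow> y b - y a"
      by (intro tendsto_diff lim ab)
  qed (use K lim left_point_in in auto)
qed

text \<open>
  A subsequential limit \<open>xbar\<close> of the translates of \<open>x\<close> solves the limiting equation, so a limit
  \<open>y\<close> of the backward translates of \<open>xbar\<close> is a bounded solution of the original equation. The
  uniqueness of bounded solutions then forces \<open>y = x\<close>.
\<close>

lemma bounded_solution_automorphic_along:
  fixes A :: "real \<Rightarrow> real^'n^'n" and x f :: "real \<Rightarrow> real^'n"
  assumes core: "ts_core T = T" and s: "\<And>n. s n \<in> ts_Pi T"
    and A: "rd_continuous T A" "\<And>t. t \<in> T \<Longrightarrow> norm (A t) \<le> M" "automorphic_along T A s Abar"
    and f: "rd_continuous T f" "\<And>t. t \<in> T \<Longrightarrow> norm (f t) \<le> F" "automorphic_along T f s fbar"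
    and x: "\<And>t. t \<in> T \<Longrightarrow> has_delta_derivative T x (A t *v x t + f t) t"
    and B: "\<And>t. t \<in> T \<Longrightarrow> norm (x t) \<le> B"
    and unique: "\<And>y. (\<And>t. t \<in> T \<Longrightarrow> has_delta_derivative T y (A t *v y t + f t) t) \<Longrightarrow>
      (\<And>t. t \<in> T \<Longrightarrow> norm (y t) \<le> B) \<Longrightarrow> (\<And>t. t \<in> T \<Longrightarrow> y t = x t)"
  shows "\<exists>r xbar. strict_mono r \<and> automorphic_along T x (s \<circ> r) xbar"
proof -
  have T_ne: "ts_core T \<noteq> {}"
    using core sigma_in by auto
  note shift = ts_core_shift[OF T_ne s]
  have rd: "rd_continuous T (\<lambda>t. A t *v y t + f t)"
    if "\<And>t. t \<in> T \<Longrightarrow> continuous (at t within T) y" for y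
    by (intro rd_continuous_add rd_continuous_bilinear[OF bounded_bilinear_matrix_vector_mult]
        rd_continuousI_continuous that A f)
  have M0: "0 \<le> M"
    using A(2)[OF sigma_in] norm_ge_zero order_trans by blast
  define K where "K = M * B + F"
  have K: "norm (C *v v + w) \<le> K" if "norm C \<le> M" "norm v \<le> B" "norm w \<le> F"
    for C :: "real^'n^'n" and v w :: "real^'n"
  proof -
    have "norm (C *v v) \<le> M * B"
      using that M0 by (intro order_trans[OF norm_matrix_vector_mult_le] mult_mono) auto
    then show ?thesis
      unfolding K_def using norm_triangle_ineq[of "C *v v" w] that(3) by linarith
  qed
  have Abar: "(\<lambda>n. A (t + s n)) \<longlonglongrightarrow> Abar t" "(\<lambda>n. Abar (t - s n)) \<longlonglongrightarrow> A t"
    and fbar: "(\<lambda>n. f (t + s n)) \<longlonglongrightarrow> fbar t" "(\<lambda>n. fbar (t - s n)) \<longlonglongrightarrow> f t" if "t \<in> T" for t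
    using A(3) f(3) that by (auto simp: automorphic_along_def core)
  have Abar_bd: "norm (Abar t) \<le> M" and fbar_bd: "norm (fbar t) \<le> F" if "t \<in> T" for t
    using A(2) f(2) shift(1)[OF that]
    by (auto intro!: LIMSEQ_le_const2[OF tendsto_norm[OF Abar(1)[OF that]]]
        LIMSEQ_le_const2[OF tendsto_norm[OF fbar(1)[OF that]]])
  \<comment> \<open>The translates solve translated equations with the common bounds \<open>B\<close> and \<open>K\<close>, so they are
    equi-Lipschitz.\<close>
  have x_inc: "has_increments x (\<lambda>t. A t *v x t + f t)"
    using has_increments_of_derivative[OF x rd] has_delta_derivative_continuous[OF _ x] by blast
  have xs_inc: "has_increments (\<lambda>t. x (t + s n)) (\<lambda>t. A (t + s n) *v x (t + s n) + f (t + s n))" for n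
    using has_increments_translate[OF x_inc, of "s n"] shift by blast
  have xs_bd: "norm (A (t + s n) *v x (t + s n) + f (t + s n)) \<le> K" if "t \<in> T" for n t
    using shift(1)[OF that] by (intro K A f B)
  obtain r xbar where r: "strict_mono r" and xbar: "\<And>t. t \<in> T \<Longrightarrow> (\<lambda>n. x (t + s (r n))) \<longlonglongrightarrow> xbar t"
  proof (rule equi_Lipschitz_subsequence[of T "\<lambda>n t. x (t + s n)" B K])
    show "norm (x (t + s n)) \<le> B" if "t \<in> T" for n t
      by (rule B[OF shift(1)[OF that]])
    show "norm (x (a + s n) - x (b + s n)) \<le> K * \<bar>a - b\<bar>" if "a \<in> T" "b \<in> T" for n a b
      using has_increments_Lipschitz[OF xs_inc xs_bd that] .
  qed blast
  have xbar_bd: "norm (xbar t) \<le> B" if "t \<in> T" for t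
    using B shift(1)[OF that] by (auto intro!: LIMSEQ_le_const2[OF tendsto_norm[OF xbar[OF that]]])
  have xbar_inc: "has_increments xbar (\<lambda>t. Abar t *v xbar t + fbar t)"
  proof (rule has_increments_limit[OF xs_inc xs_bd])
    show "(\<lambda>n. x (t + s (r n))) \<longlonglongrightarrow> xbar t" if "t \<in> T" for t
      by (rule xbar[OF that])
    show "(\<lambda>n. A (t + s (r n)) *v x (t + s (r n)) + f (t + s (r n))) \<longlonglongrightarrow> Abar t *v xbar t + fbar t"
      if "t \<in> T" for t
      using LIMSEQ_subseq_LIMSEQ[OF Abar(1)[OF that] r] LIMSEQ_subseq_LIMSEQ[OF fbar(1)[OF that] r]
      by (intro tendsto_add mvm.tendsto xbar that) (simp_all add: o_def)
  qed
  \<comment> \<open>The bounds pass to \<open>xbar\<close>, so its backward translates are equi-Lipschitz as well.\<close>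
  have zs_inc: "has_increments (\<lambda>t. xbar (t - s n)) (\<lambda>t. Abar (t - s n) *v xbar (t - s n) + fbar (t - s n))" for n
    using has_increments_translate[OF xbar_inc, of "- s n"] shift by simp
  have zs_bd: "norm (Abar (t - s n) *v xbar (t - s n) + fbar (t - s n)) \<le> K" if "t \<in> T" for n t
    using shift(2)[OF that] by (intro K Abar_bd fbar_bd xbar_bd)
  obtain r' y where r': "strict_mono r'"
    and y: "\<And>t. t \<in> T \<Longrightarrow> (\<lambda>n. xbar (t - s (r (r' n)))) \<longlonglongrightarrow> y t"
  proof (rule equi_Lipschitz_subsequence[of T "\<lambda>n t. xbar (t - s (r n))" B K])
    show "norm (xbar (t - s (r n))) \<le> B" if "t \<in> T" for n t
      by (rule xbar_bd[OF shift(2)[OF that]])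
    show "norm (xbar (a - s (r n)) - xbar (b - s (r n))) \<le> K * \<bar>a - b\<bar>" if "a \<in> T" "b \<in> T" for n a b
      using has_increments_Lipschitz[OF zs_inc zs_bd that] .
  qed blast
  note rr' = strict_mono_o[OF r r']
  have y_inc: "has_increments y (\<lambda>t. A t *v y t + f t)"
  proof (rule has_increments_limit[OF zs_inc zs_bd])
    show "(\<lambda>n. xbar (t - s (r (r' n)))) \<longlonglongrightarrow> y t" if "t \<in> T" for t
      by (rule y[OF that])
    show "(\<lambda>n. Abar (t - s (r (r' n))) *v xbar (t - s (r (r' n))) + fbar (t - s (r (r' n))))
        \<longlonglongrightarrow> A t *v y t + f t" if "t \<in> T" for t
      using LIMSEQ_subseq_LIMSEQ[OF Abar(2)[OF that] rr'] LIMSEQ_subseq_LIMSEQ[OF fbar(2)[OF that] rr']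
      by (intro tendsto_add mvm.tendsto y that) (simp_all add: o_def)
  qed
  have y_bd: "norm (y t) \<le> B" if "t \<in> T" for t
    using xbar_bd shift(2)[OF that] by (auto intro!: LIMSEQ_le_const2[OF tendsto_norm[OF y[OF that]]])
  have y_cont: "continuous (at t within T) y" if "t \<in> T" for t
    unfolding continuous_within
  proof (rule LIM_zero_cancel, rule tendsto_0_le[of _ _ _ K])
    show "((\<lambda>s. s - t) \<longlongrightarrow> 0) (at t within T)"
      by (rule LIM_zero) (rule tendsto_ident_at)
    show "\<forall>\<^sub>F s in at t within T. norm (y s - y t) \<le> norm (s - t) * K"
      using has_increments_Lipschitz[OF y_inc K[OF A(2) y_bd f(2)] _ that]
      by (auto simp: eventually_at_filter mult.commute)
  qed
  have "y t = x t" if "t \<in> T" for t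
    using unique[OF has_increments_derivative[OF y_inc rd[OF y_cont]] y_bd that] by simp
  then have "automorphic_along T x (s \<circ> (r \<circ> r')) xbar"
    using LIMSEQ_subseq_LIMSEQ[OF xbar r'] y
    by (auto simp: automorphic_along_def core o_def)
  then show ?thesis
    using rr' by blast
qed

lemma almost_automorphic_regressivity_matrix:
  fixes A :: "real \<Rightarrow> real^'n^'n"
  assumes A: "almost_automorphic T A"
  shows "almost_automorphic T (\<lambda>t. mat 1 + \<mu> t *\<^sub>R A t)"
  unfolding almost_automorphic_iff
proof (intro conjI allI impI)
  obtain M where M: "\<And>t. t \<in> T \<Longrightarrow> norm (A t) \<le> M"
    using almost_automorphic_bounded[OF A] by blast
  have "norm (mat 1 + \<mu> t *\<^sub>R A t) \<le> norm (mat 1 :: real^'n^'n) + m * M" if "t \<in> T" for t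
  proof -
    have "norm (\<mu> t *\<^sub>R A t) \<le> m * M"
      using graininess_bounds[of t] M[OF that] m_pos by (auto intro!: mult_mono)
    then show ?thesis
      using norm_triangle_ineq[of "mat 1 :: real^'n^'n" "\<mu> t *\<^sub>R A t"] by linarith
  qed
  then show "bounded ((\<lambda>t. mat 1 + \<mu> t *\<^sub>R A t) ` T)"
    unfolding bounded_iff by blast
  have "rd_continuous T A"
    using A by (simp add: almost_automorphic_def)
  then show "rd_continuous T (\<lambda>t. mat 1 + \<mu> t *\<^sub>R A t)"
    by (intro rd_continuous_add rd_continuous_const rd_continuous_bilinear[OF bounded_bilinear_scaleR]
        rd_continuous_graininess_comp[where F = "\<lambda>x. x"]) simp_all
  fix s :: "nat \<Rightarrow> real" assume s: "\<forall>n. s n \<in> ts_Pi T"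
  then obtain r Abar where r: "strict_mono r" and Abar: "automorphic_along T A (s \<circ> r) Abar"
    using A unfolding almost_automorphic_iff by blast
  have "automorphic_along T (\<lambda>t. mat 1 + \<mu> t *\<^sub>R A t) (s \<circ> r) (\<lambda>t. mat 1 + \<mu> t *\<^sub>R Abar t)"
  proof (cases "ts_core T = {}")
    case True
    then show ?thesis by (simp add: automorphic_along_def)
  next
    case False
    have "\<mu> (t + s n) = \<mu> t" "\<mu> (t - s n) = \<mu> t" for n t
      using graininess_translate[of "s n" t] graininess_translate[of "- s n" t]
        ts_core_shift[OF False, of "s n"] s by simp_all
    then show ?thesis
      using Abar unfolding automorphic_along_def by (auto intro!: tendsto_intros)
  qed
  then show "\<exists>r hbar. strict_mono r \<and> automorphic_along T (\<lambda>t. mat 1 + \<mu> t *\<^sub>R A t) (s \<circ> r) hbar"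
    using r by blast
qed

end

text \<open>
  For an empty core the condition on translates is vacuous. Otherwise one subsequence is chosen
  along which the translates of both \<open>A\<close> and \<open>f\<close> converge.
\<close>

lemma (in dichotomous_system) bounded_solution_almost_automorphic:
  assumes A: "almost_automorphic T A" and f: "almost_automorphic T f"
    and x: "\<And>t. t \<in> T \<Longrightarrow> has_delta_derivative T x (A t *v x t + f t) t"
    and B: "\<And>t. t \<in> T \<Longrightarrow> norm (x t) \<le> B"
  shows "almost_automorphic T x"
  unfolding almost_automorphic_iff
proof (intro conjI allI impI)
  show "bounded (x ` T)"
    using B unfolding bounded_iff by blast
  show "rd_continuous T x"
    by (rule rd_continuousI_continuous[OF has_delta_derivative_continuous[OF _ x]])
  obtain M F where M: "\<And>t. t \<in> T \<Longrightarrow> norm (A t) \<le> M" and F: "\<And>t. t \<in> T \<Longrightarrow> norm (f t) \<le> F"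
    using almost_automorphic_bounded[OF A] almost_automorphic_bounded[OF f] by metis
  fix s :: "nat \<Rightarrow> real" assume s: "\<forall>n. s n \<in> ts_Pi T"
  show "\<exists>r xbar. strict_mono r \<and> automorphic_along T x (s \<circ> r) xbar"
  proof (cases "ts_core T = {}")
    case True
    then show ?thesis
      using strict_mono_id by (auto simp: automorphic_along_def)
  next
    case False
    obtain r Abar where r: "strict_mono r" "automorphic_along T A (s \<circ> r) Abar"
      using A s unfolding almost_automorphic_iff by blast
    obtain r' fbar where r': "strict_mono r'" "automorphic_along T f (s \<circ> r \<circ> r') fbar"
      using f s unfolding almost_automorphic_iff by (metis comp_apply)
    have core: "ts_core T = T"
      using ts_core_eq[OF False] sigma_in by blast
    have rd: "rd_continuous T A" "rd_continuous T f"
      using A f by (simp_all add: almost_automorphic_def)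
    have unique: "y t = x t"
      if "\<And>t. t \<in> T \<Longrightarrow> has_delta_derivative T y (A t *v y t + f t) t"
        "\<And>t. t \<in> T \<Longrightarrow> norm (y t) \<le> B" "t \<in> T" for y t
      using bounded_solution_unique[OF that(1) x that(2) B that(3)] .
    have "\<exists>r'' xbar. strict_mono r'' \<and> automorphic_along T x (s \<circ> r \<circ> r' \<circ> r'') xbar"
    proof (rule bounded_solution_automorphic_along[where A = A and f = f and M = M and F = F and B = B])
      show "(s \<circ> r \<circ> r') n \<in> ts_Pi T" for n
        using s by simp
    qed (fact core rd M F automorphic_along_subseq[OF r(2) r'(1)] r'(2) x B unique)+
    then show ?thesis
      using strict_mono_o[OF strict_mono_o[OF r(1) r'(1)]] by (metis comp_assoc)
  qed
qed

theorem lemma4p1: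
  fixes T :: "real set" and A :: "real \<Rightarrow> real^'n^'n"
  assumes "almost_periodic_time_scale T"
    and "rd_regressive T A"
    and "mat_almost_automorphic T A"
    and "\<forall>t\<in>T. invertible (A t)"
    and "bounded ((\<lambda>t. matrix_inv (A t)) ` T)"
    and "bounded ((\<lambda>t. matrix_inv (mat 1 + graininess T t *\<^sub>R A t)) ` T)"
  shows "mat_almost_automorphic T (\<lambda>t. matrix_inv (A t)) \<and>
    mat_almost_automorphic T (\<lambda>t. matrix_inv (mat 1 + graininess T t *\<^sub>R A t)) \<and>
    (\<forall>(f :: real \<Rightarrow> real^'n) (X :: real \<Rightarrow> real^'n^'n) (P :: real^'n^'n).
       almost_automorphic T f \<longrightarrow> exponential_dichotomy T A X P \<longrightarrow>
       (\<exists>x :: real \<Rightarrow> real^'n. almost_automorphic T x \<and>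
          (\<forall>t\<in>T. has_delta_derivative T x (A t *v x t + f t) t) \<and>
          (\<forall>t\<in>T. \<exists>I1 I2.
             has_delta_integral_from_bot T
               (\<lambda>s. (X t ** P ** matrix_inv (X (fwd_jump T s))) *v f s) t I1 \<and>
             has_delta_integral_to_top T
               (\<lambda>s. (X t ** (mat 1 - P) ** matrix_inv (X (fwd_jump T s))) *v f s) t I2 \<and>
             x t = I1 - I2)))"
proof (intro conjI allI impI)
  obtain m where "relatively_dense_time_scale T m"
    using almost_periodic_relatively_dense[OF assms(1)] by blast
  then interpret relatively_dense_time_scale T m .
  have T_ne: "T \<noteq> {}"
    using sigma_in by blast
  have A: "almost_automorphic T A"
    using assms(3) by (simp add: mat_almost_automorphic_iff)
  show "mat_almost_automorphic T (\<lambda>t. matrix_inv (A t))"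
    unfolding mat_almost_automorphic_iff
    using assms(4,5) by (intro almost_automorphic_matrix_inv[OF A _ _ T_ne]) auto
  show "mat_almost_automorphic T (\<lambda>t. matrix_inv (mat 1 + \<mu> t *\<^sub>R A t))"
    unfolding mat_almost_automorphic_iff
    using assms(2,6)
    by (intro almost_automorphic_matrix_inv[OF almost_automorphic_regressivity_matrix[OF A] _ _ T_ne])
       (auto simp: rd_regressive_def)
  fix f :: "real \<Rightarrow> real^'n" and X :: "real \<Rightarrow> real^'n^'n" and P :: "real^'n^'n"
  assume f: "almost_automorphic T f" and X: "exponential_dichotomy T A X P"
  obtain k \<beta> where "dichotomous_system T m A X P k \<beta>"
  proof (rule exponential_dichotomy_exp_bounds[OF X], rule that, unfold_locales)
    show "fundamental_matrix T A X"
      using X by (simp add: exponential_dichotomy_def)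
  qed
  then interpret dichotomous_system T m A X P k \<beta> .
  obtain F where F: "\<And>t. t \<in> T \<Longrightarrow> norm (f t) \<le> F"
    using almost_automorphic_bounded[OF f] by blast
  have rd: "rd_continuous T f"
    using f by (simp add: almost_automorphic_def)
  show "\<exists>x. almost_automorphic T x \<and>
      (\<forall>t\<in>T. has_delta_derivative T x (A t *v x t + f t) t) \<and>
      (\<forall>t\<in>T. \<exists>I1 I2.
        has_delta_integral_from_bot T (\<lambda>s. (X t ** P ** matrix_inv (X (\<sigma> s))) *v f s) t I1 \<and>
        has_delta_integral_to_top T (\<lambda>s. (X t ** (mat 1 - P) ** matrix_inv (X (\<sigma> s))) *v f s) t I2 \<and>
        x t = I1 - I2)"
  proof (rule bounded_solution_exists[OF rd F])
    fix x B
    assume x: "\<And>t. t \<in> T \<Longrightarrow> has_delta_derivative T x (A t *v x t + f t) t"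
      and B: "\<And>t. t \<in> T \<Longrightarrow> norm (x t) \<le> B"
      and int: "\<And>t. t \<in> T \<Longrightarrow> \<exists>I1 I2.
        has_delta_integral_from_bot T (\<lambda>s. (X t ** P ** matrix_inv (X (\<sigma> s))) *v f s) t I1 \<and>
        has_delta_integral_to_top T (\<lambda>s. (X t ** (mat 1 - P) ** matrix_inv (X (\<sigma> s))) *v f s) t I2 \<and>
        x t = I1 - I2"
    show ?thesis
      using bounded_solution_almost_automorphic[OF A f x B] x int by (intro exI[of _ x] conjI ballI)
  qed
qed

end
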